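(* Let $L>0$, let $c\in(2\pi^2/L^2,+\infty)$ and $\omega(c)=2c$. Then the cnoidal wave $\phi_c=\varphi_{\omega(c)}/4$ has fundamental period $L$ and satisfies $$-\phi_c''+2c\phi_c-2\phi_c^2=0.$$ Moreover, the mapping $$c\in\left(\frac{2\pi^2}{L^2},+\infty\right)\mapsto\phi_c\in H^n_{per}([0,L]),\qquad n=0,1,\ldots$$ is a smooth function. In addition, the elliptic modulus $k=k(c)$ of $\phi_c$ satisfies $dk/dc>0$.
   Context: $K(k)=\int_0^1\frac{dt}{\sqrt{(1-t^2)(1-k^2t^2)}}$ is the complete elliptic integral of the first kind, and $cn(\cdot;k)$ is the Jacobi elliptic cnoidal function of modulus $k$. $H^n_{per}([0,L])$ is the Sobolev space of order $n$ of $L$-periodic functions. For $L>0$ fixed and $\omega>4\pi^2/L^2$, the cnoidal wave $\varphi_\omega$ is defined as follows. For $\beta_3\in(2\omega,3\omega)$ put $\beta_2=\tfrac12\left(3\omega-\beta_3+\sqrt{9\omega^2+6\omega\beta_3-3\beta_3^2}\right)$, $\beta_1=3\omega-\beta_2-\beta_3$ and $k^2=\frac{\beta_3-\beta_2}{\beta_3-\beta_1}\in(0,1)$; then $\beta_3=\beta_3(\omega)$ is chosen as the unique element of $(2\omega,3\omega)$ with $\frac{4\sqrt3}{\sqrt{\beta_3-\beta_1}}K(k)=L$, and $$\varphi_\omega(x)=\beta_2+(\beta_3-\beta_2)\,cn^2\!\left(\sqrt{\tfrac{\beta_3-\beta_1}{12}}\,x;k\right).$$ *)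

theory Defs
  imports "HOL-Analysis.Analysis"
begin

definition elliptic_K :: "real \<Rightarrow> real" where
  "elliptic_K k = (LBINT t=0..1. 1 / sqrt ((1 - t\<^sup>2) * (1 - k\<^sup>2 * t\<^sup>2)))"

text \<open>The Jacobi functions are obtained by inverting the incomplete elliptic integral
  of the first kind (an oriented integral, so that negative amplitudes are covered).
  For \<open>0 \<le> k < 1\<close> the map \<open>\<lambda>\<theta>. elliptic_F \<theta> k\<close> is a bijection of the real line.\<close>

definition elliptic_F :: "real \<Rightarrow> real \<Rightarrow> real" where
  "elliptic_F \<theta> k = (LBINT s=0..ereal \<theta>. 1 / sqrt (1 - k\<^sup>2 * (sin s)\<^sup>2))"

definition jacobi_am :: "real \<Rightarrow> real \<Rightarrow> real" where
  "jacobi_am u k = (THE \<theta>. elliptic_F \<theta> k = u)"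

definition jacobi_cn :: "real \<Rightarrow> real \<Rightarrow> real" where
  "jacobi_cn u k = cos (jacobi_am u k)"

text \<open>The numbers \<open>\<beta>\<^sub>1 < \<beta>\<^sub>2 < \<beta>\<^sub>3\<close> satisfy \<open>\<beta>\<^sub>1 + \<beta>\<^sub>2 + \<beta>\<^sub>3 = 3 \<omega>\<close> and
  \<open>\<beta>\<^sub>1 \<beta>\<^sub>2 + \<beta>\<^sub>1 \<beta>\<^sub>3 + \<beta>\<^sub>2 \<beta>\<^sub>3 = 0\<close>, and the wave solves
  \<open>3 (\<phi>')\<^sup>2 = (\<phi> - \<beta>\<^sub>1) (\<phi> - \<beta>\<^sub>2) (\<beta>\<^sub>3 - \<phi>)\<close>, hence \<open>- \<phi>'' + \<omega> \<phi> - \<phi>\<^sup>2 / 2 = 0\<close>.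
  The largest root is fixed by prescribing the period \<open>L\<close>; the definite description is
  meaningful for \<open>L > 0\<close> and \<open>\<omega> > 4 \<pi>\<^sup>2 / L\<^sup>2\<close>.\<close>

definition beta2_of :: "real \<Rightarrow> real \<Rightarrow> real" where
  "beta2_of \<omega> b3 = (3 * \<omega> - b3 + sqrt (9 * \<omega>\<^sup>2 + 6 * \<omega> * b3 - 3 * b3\<^sup>2)) / 2"

definition beta1_of :: "real \<Rightarrow> real \<Rightarrow> real" where
  "beta1_of \<omega> b3 = 3 * \<omega> - beta2_of \<omega> b3 - b3"

definition modulus_of :: "real \<Rightarrow> real \<Rightarrow> real" where
  "modulus_of \<omega> b3 = sqrt ((b3 - beta2_of \<omega> b3) / (b3 - beta1_of \<omega> b3))"

definition beta3 :: "real \<Rightarrow> real \<Rightarrow> real" where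
  "beta3 L \<omega> = (THE b3. b3 \<in> {2 * \<omega> <..< 3 * \<omega>} \<and>
     4 * sqrt 3 / sqrt (b3 - beta1_of \<omega> b3) * elliptic_K (modulus_of \<omega> b3) = L)"

definition beta2 :: "real \<Rightarrow> real \<Rightarrow> real" where
  "beta2 L \<omega> = beta2_of \<omega> (beta3 L \<omega>)"

definition beta1 :: "real \<Rightarrow> real \<Rightarrow> real" where
  "beta1 L \<omega> = beta1_of \<omega> (beta3 L \<omega>)"

definition modulus :: "real \<Rightarrow> real \<Rightarrow> real" where
  "modulus L \<omega> = modulus_of \<omega> (beta3 L \<omega>)"

definition cnoidal :: "real \<Rightarrow> real \<Rightarrow> real \<Rightarrow> real" where
  "cnoidal L \<omega> x = beta2 L \<omega> + (beta3 L \<omega> - beta2 L \<omega>) *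
     (jacobi_cn (sqrt ((beta3 L \<omega> - beta1 L \<omega>) / 12) * x) (modulus L \<omega>))\<^sup>2"

definition phi :: "real \<Rightarrow> real \<Rightarrow> real \<Rightarrow> real" where
  "phi L c x = cnoidal L (2 * c) x / 4"

definition fundamental_period :: "(real \<Rightarrow> real) \<Rightarrow> real \<Rightarrow> bool" where
  "fundamental_period f T \<longleftrightarrow> T > 0 \<and> (\<forall>x. f (x + T) = f x) \<and>
     (\<forall>S>0. (\<forall>x. f (x + S) = f x) \<longrightarrow> T \<le> S)"

text \<open>Periodic Sobolev spaces of real-valued functions, defined by the usual weighted
  square summability of the Fourier coefficients. As the order is a natural number, all
  elements are square integrable functions. Functions are not identified
  when they agree almost everywhere, so \<open>Hper_norm\<close> is only a seminorm; it is meaningful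
  on \<open>Hper L n\<close>, which is a real vector space.\<close>

definition fourier_coeff :: "real \<Rightarrow> (real \<Rightarrow> real) \<Rightarrow> int \<Rightarrow> complex" where
  "fourier_coeff L f m =
     complex_of_real (1 / L) * (LINT x:{0..L}|lborel. complex_of_real (f x) * cis (- 2 * pi * of_int m * x / L))"

definition Hper :: "real \<Rightarrow> nat \<Rightarrow> (real \<Rightarrow> real) set" where
  "Hper L n = {f. f \<in> borel_measurable borel \<and> (\<forall>x. f (x + L) = f x) \<and>
     set_integrable lborel {0..L} (\<lambda>x. (f x)\<^sup>2) \<and>
     (\<lambda>m::int. (1 + (of_int m)\<^sup>2) ^ n * (cmod (fourier_coeff L f m))\<^sup>2) summable_on UNIV}"

definition Hper_norm :: "real \<Rightarrow> nat \<Rightarrow> (real \<Rightarrow> real) \<Rightarrow> real" where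
  "Hper_norm L n f =
     sqrt (L * (\<Sum>\<^sub>\<infinity>m::int. (1 + (of_int m)\<^sup>2) ^ n * (cmod (fourier_coeff L f m))\<^sup>2))"

text \<open>Differentiability of a curve in \<open>Hper L n\<close> at \<open>c\<close>, as norm convergence of the
  difference quotients, and smoothness on an open set \<open>S\<close> of parameters:
  \<open>D j\<close> is the \<open>j\<close>-th derivative of the curve, and all orders exist. The derivatives are
  determined by the curve up to almost everywhere equality.\<close>

definition has_Hper_derivative ::
  "real \<Rightarrow> nat \<Rightarrow> (real \<Rightarrow> real \<Rightarrow> real) \<Rightarrow> (real \<Rightarrow> real) \<Rightarrow> real \<Rightarrow> bool" where
  "has_Hper_derivative L n u v c \<longleftrightarrow>
     ((\<lambda>h. Hper_norm L n (\<lambda>x. (u (c + h) x - u c x) / h - v x)) \<longlongrightarrow> 0) (at 0)"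

definition Hper_smooth_on ::
  "real \<Rightarrow> nat \<Rightarrow> real set \<Rightarrow> (real \<Rightarrow> real \<Rightarrow> real) \<Rightarrow> bool" where
  "Hper_smooth_on L n S u \<longleftrightarrow> (\<exists>D :: nat \<Rightarrow> real \<Rightarrow> real \<Rightarrow> real.
     (\<forall>c\<in>S. D 0 c = u c) \<and>
     (\<forall>j. \<forall>c\<in>S. D j c \<in> Hper L n \<and> has_Hper_derivative L n (D j) (D (Suc j) c) c))"

end

theory Submission
  imports Defs
begin

text \<open>With \<open>m = k\<^sup>2\<close> and \<open>D = \<beta>\<^sub>3 - \<beta>\<^sub>1\<close>, the two algebraic relations between the \<open>\<beta>\<^sub>i\<close> become
  \<open>D\<^sup>2 (1 - m + m\<^sup>2) = 9 \<omega>\<^sup>2\<close>, and the period condition becomes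
  \<open>\<omega> = 16 K(m)\<^sup>2 sqrt (1 - m + m\<^sup>2) / L\<^sup>2\<close>. The right-hand side increases from \<open>4 \<pi>\<^sup>2 / L\<^sup>2\<close> to
  infinity with positive derivative on \<open>0 < m < 1\<close>, so \<open>m\<close> is a smooth increasing function of
  \<open>\<omega>\<close>. By the implicit function theorem the amplitude, and with it the wave, is jointly smooth in
  \<open>(c, x)\<close>. For a jointly smooth periodic function, integrating the Fourier coefficients by
  parts in \<open>x\<close> turns uniform bounds into bounds in every periodic Sobolev norm; the mean value
  theorem applied to each Fourier coefficient as a function of \<open>c\<close> then gives the
  derivatives of the curve.\<close>

subsection \<open>Smooth functions\<close>

text \<open>The formulas in m rest on two identities. Adding the two gaps to the sum of the roots
  gives 3 \<open>\<beta>\<^sub>3\<close> = 3 \<omega> + D + m D. Half the sum of the squared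
  differences of the roots is D^2 (1 - m + m^2), and it equals 9 \<omega>^2 because the pairwise
  products sum to 0. So \<omega> and m fix all three roots, and the definite description
  \<open>beta3\<close> can be evaluated once this parametrization is known to exhaust (2 \<omega>, 3
  \<omega>). The delicate point is the sign of the derivative of K^2 sqrt (1 - m + m^2): the root
  factor decreases for m < 1/2, so a quantitative lower bound on K' is required. Working with m
  instead of k makes \<open>ellF\<close> and \<open>wave_freq\<close> smooth for all m < 1, so that
  the threshold frequency is just the value at the interior point m = 0. The Sobolev estimates spend
  one extra order: bounds on the x-derivatives of orders 0 and n + 1 control each Fourier
  coefficient with weight exponent n + 1, and the spare factor 1 / (1 + j^2) makes the series over
  the frequencies j converge.\<close>

primrec Ck_on :: "nat \<Rightarrow> 'a::real_normed_vector set \<Rightarrow> ('a \<Rightarrow> 'b::real_normed_vector) \<Rightarrow> bool" where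
  "Ck_on 0 U f \<longleftrightarrow> continuous_on U f"
| "Ck_on (Suc n) U f \<longleftrightarrow> (\<forall>p\<in>U. f differentiable at p) \<and>
     (\<forall>v. Ck_on n U (\<lambda>p. frechet_derivative f (at p) v))"

text \<open>Derivatives enter \<open>Ck_on\<close> only through their values at fixed directions v.
  Each derivative then keeps the type of f and the recursion stays within one type, which iterated
  spaces of linear maps would not allow. On open subsets of finite-dimensional spaces this is the
  usual notion.\<close>

definition smooth_on :: "'a::real_normed_vector set \<Rightarrow> ('a \<Rightarrow> 'b::real_normed_vector) \<Rightarrow> bool" where
  "smooth_on U f \<longleftrightarrow> (\<forall>n. Ck_on n U f)"

lemma Ck_on_cong:
  assumes "open U" "\<And>p. p \<in> U \<Longrightarrow> f p = g p" "Ck_on n U f"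
  shows "Ck_on n U g"
  using assms(2,3)
proof (induction n arbitrary: f g)
  case 0
  then show ?case by (metis Ck_on.simps(1) continuous_on_cong)
next
  case (Suc n)
  have "(g has_derivative frechet_derivative f (at p)) (at p)" if "p \<in> U" for p
    using Suc.prems that assms(1)
    by (auto intro: has_derivative_transform_within_open[of f _ p UNIV U] simp: frechet_derivative_works[symmetric])
  then have der: "g differentiable at p \<and> frechet_derivative g (at p) = frechet_derivative f (at p)" if "p \<in> U" for p
    using that frechet_derivative_at differentiable_def by metis
  have "Ck_on n U (\<lambda>p. frechet_derivative g (at p) v)" for v
    by (rule Suc.IH[of "\<lambda>p. frechet_derivative f (at p) v"]) (use der Suc.prems in auto)
  then show ?case using der by simp
qed

text \<open>Trades the chosen \<open>frechet_derivative\<close> for whatever formula f' is at hand,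
  so that an induction hypothesis of order n can be applied to that formula.\<close>

lemma Ck_on_SucI:
  assumes "open U" "\<And>p. p \<in> U \<Longrightarrow> (f has_derivative f' p) (at p)" "\<And>v. Ck_on n U (\<lambda>p. f' p v)"
  shows "Ck_on (Suc n) U f"
proof -
  have "frechet_derivative f (at p) = f' p" if "p \<in> U" for p
    by (rule frechet_derivative_at[OF assms(2)[OF that], symmetric])
  then have "Ck_on n U (\<lambda>p. frechet_derivative f (at p) v)" for v
    by (intro Ck_on_cong[OF assms(1) _ assms(3)[of v]]) auto
  then show ?thesis using assms(2) by (auto simp: differentiable_def)
qed

lemma Ck_on_SucD:
  assumes "Ck_on (Suc n) U f"
  obtains f' where "\<And>p. p \<in> U \<Longrightarrow> (f has_derivative f' p) (at p)" "\<And>v. Ck_on n U (\<lambda>p. f' p v)"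
  using assms that[of "\<lambda>p. frechet_derivative f (at p)"] frechet_derivative_works by auto

lemma Ck_on_imp_continuous_on: "Ck_on n U f \<Longrightarrow> continuous_on U f"
  by (cases n)
    (simp_all add: continuous_at_imp_continuous_on differentiable_imp_continuous_within)

lemma Ck_on_Suc_imp: "Ck_on (Suc n) U f \<Longrightarrow> Ck_on n U f"
proof (induction n arbitrary: f)
  case 0
  then show ?case using Ck_on_imp_continuous_on Ck_on.simps(1) by blast
next
  case (Suc n)
  have "Ck_on n U (\<lambda>p. frechet_derivative f (at p) v)" for v
    by (rule Suc.IH) (use Suc.prems in simp)
  then show ?case using Suc.prems by simp
qed

lemma Ck_on_subset: "Ck_on n U f \<Longrightarrow> V \<subseteq> U \<Longrightarrow> Ck_on n V f"
proof (induction n arbitrary: f)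
  case 0
  then show ?case by (auto intro: continuous_on_subset)
next
  case (Suc n)
  have "Ck_on n V (\<lambda>p. frechet_derivative f (at p) v)" for v
    by (rule Suc.IH) (use Suc.prems in simp_all)
  then show ?case using Suc.prems by auto
qed

lemma Ck_on_const: "Ck_on n U (\<lambda>p. c)"
  by (induction n arbitrary: c) simp_all

lemma Ck_on_bounded_linear: 
  assumes "bounded_linear f" shows "Ck_on n UNIV f"
proof (cases n)
  case 0
  then show ?thesis using assms by (simp add: bounded_linear.linear linear_continuous_on)
next
  case (Suc k)
  show ?thesis unfolding Suc
    by (rule Ck_on_SucI[where f'="\<lambda>_. f"]) (simp_all add: Ck_on_const bounded_linear_imp_has_derivative assms)
qed

lemma Ck_on_linear_compose: 
  assumes "open U" "Ck_on n U f" "bounded_linear h" shows "Ck_on n U (\<lambda>p. h (f p))"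
  using assms(2)
proof (induction n arbitrary: f)
  case 0
  then show ?case using assms by (auto intro: bounded_linear.continuous_on)
next
  case (Suc n)
  obtain f' where f': "\<And>p. p \<in> U \<Longrightarrow> (f has_derivative f' p) (at p)" "\<And>v. Ck_on n U (\<lambda>p. f' p v)"
    using Ck_on_SucD[OF Suc.prems] by blast
  show ?case
    using Ck_on_SucI[OF assms(1) bounded_linear.has_derivative[OF assms(3) f'(1)] Suc.IH[OF f'(2)]] .
qed

lemma Ck_on_add: 
  assumes "open U" "Ck_on n U f" "Ck_on n U g" shows "Ck_on n U (\<lambda>p. f p + g p)"
  using assms(2,3)
proof (induction n arbitrary: f g)
  case 0
  then show ?case by (auto intro: continuous_intros)
next
  case (Suc n)
  obtain f' where f': "\<And>p. p \<in> U \<Longrightarrow> (f has_derivative f' p) (at p)" "\<And>v. Ck_on n U (\<lambda>p. f' p v)"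
    using Ck_on_SucD[OF Suc.prems(1)] by blast
  obtain g' where g': "\<And>p. p \<in> U \<Longrightarrow> (g has_derivative g' p) (at p)" "\<And>v. Ck_on n U (\<lambda>p. g' p v)"
    using Ck_on_SucD[OF Suc.prems(2)] by blast
  show ?case
    using Ck_on_SucI[OF assms(1) has_derivative_add[OF f'(1) g'(1)] Suc.IH[OF f'(2) g'(2)]] .
qed

lemma Ck_on_sum:
  assumes "open U" "\<And>i. i \<in> I \<Longrightarrow> Ck_on n U (f i)" shows "Ck_on n U (\<lambda>p. \<Sum>i\<in>I. f i p)"
  using assms(2) by (induction I rule: infinite_finite_induct) (simp_all add: Ck_on_const Ck_on_add assms)

lemma Ck_on_bilinear: 
  assumes "open U" "bounded_bilinear h" "Ck_on n U f" "Ck_on n U g" shows "Ck_on n U (\<lambda>p. h (f p) (g p))"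
  using assms(3,4)
proof (induction n arbitrary: f g)
  case 0
  then show ?case using assms by (auto intro: bounded_bilinear.continuous_on)
next
  case (Suc n)
  obtain f' where f': "\<And>p. p \<in> U \<Longrightarrow> (f has_derivative f' p) (at p)" "\<And>v. Ck_on n U (\<lambda>p. f' p v)"
    using Ck_on_SucD[OF Suc.prems(1)] by blast
  obtain g' where g': "\<And>p. p \<in> U \<Longrightarrow> (g has_derivative g' p) (at p)" "\<And>v. Ck_on n U (\<lambda>p. g' p v)"
    using Ck_on_SucD[OF Suc.prems(2)] by blast
  show ?case
    using Ck_on_SucI[OF assms(1) bounded_bilinear.FDERIV[OF assms(2) f'(1) g'(1)]
        Ck_on_add[OF assms(1) Suc.IH[OF Suc.prems(1)[THEN Ck_on_Suc_imp] g'(2)]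
          Suc.IH[OF f'(2) Suc.prems(2)[THEN Ck_on_Suc_imp]]]] .
qed

lemma Ck_on_Pair: 
  assumes "open U" "Ck_on n U f" "Ck_on n U g" shows "Ck_on n U (\<lambda>p. (f p, g p))"
  using assms(2,3)
proof (induction n arbitrary: f g)
  case 0
  then show ?case by (auto intro: continuous_intros)
next
  case (Suc n)
  obtain f' where f': "\<And>p. p \<in> U \<Longrightarrow> (f has_derivative f' p) (at p)" "\<And>v. Ck_on n U (\<lambda>p. f' p v)"
    using Ck_on_SucD[OF Suc.prems(1)] by blast
  obtain g' where g': "\<And>p. p \<in> U \<Longrightarrow> (g has_derivative g' p) (at p)" "\<And>v. Ck_on n U (\<lambda>p. g' p v)"
    using Ck_on_SucD[OF Suc.prems(2)] by blast
  show ?case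
    using Ck_on_SucI[OF assms(1) has_derivative_Pair[OF f'(1) g'(1)] Suc.IH[OF f'(2) g'(2)]] .
qed

text \<open>The induction hypothesis covers h' only at fixed directions, whereas the chain rule
  evaluates it at the moving vector f' p v. Expanding that vector in \<open>Basis\<close> gives a
  finite sum of scalars times h' (f p) b; this is why the middle space is Euclidean.\<close>

lemma Ck_on_compose:
  fixes h :: "'b::euclidean_space \<Rightarrow> 'c::real_normed_vector"
  assumes "open U" "open V" "Ck_on n V h" "Ck_on n U f" "f ` U \<subseteq> V"
  shows "Ck_on n U (\<lambda>p. h (f p))"
  using assms(3-5)
proof (induction n arbitrary: f h)
  case 0
  then show ?case by (auto intro: continuous_on_compose2)
next
  case (Suc n)
  obtain f' where f': "\<And>p. p \<in> U \<Longrightarrow> (f has_derivative f' p) (at p)" "\<And>v. Ck_on n U (\<lambda>p. f' p v)"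
    using Ck_on_SucD[OF Suc.prems(2)] by blast
  obtain h' where h': "\<And>p. p \<in> V \<Longrightarrow> (h has_derivative h' p) (at p)" "\<And>v. Ck_on n V (\<lambda>p. h' p v)"
    using Ck_on_SucD[OF Suc.prems(1)] by blast
  show ?case
  proof (rule Ck_on_SucI[where f'="\<lambda>p v. \<Sum>b\<in>Basis. (f' p v \<bullet> b) *\<^sub>R h' (f p) b"])
    fix p assume "p \<in> U"
    then have fp: "f p \<in> V" using Suc.prems(3) by blast
    have "((\<lambda>p. h (f p)) has_derivative (\<lambda>v. h' (f p) (f' p v))) (at p)"
      by (rule has_derivative_compose[OF f'(1)[OF \<open>p \<in> U\<close>] h'(1)[OF fp]])
    also have "(\<lambda>v. h' (f p) (f' p v)) = (\<lambda>v. \<Sum>b\<in>Basis. (f' p v \<bullet> b) *\<^sub>R h' (f p) b)"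
    proof
      fix v
      have lin: "linear (h' (f p))"
        by (rule has_derivative_linear[OF h'(1)[OF fp]])
      have "h' (f p) (f' p v) = h' (f p) (\<Sum>b\<in>Basis. (f' p v \<bullet> b) *\<^sub>R b)"
        by (simp add: euclidean_representation)
      also have "\<dots> = (\<Sum>b\<in>Basis. (f' p v \<bullet> b) *\<^sub>R h' (f p) b)"
        by (simp only: linear_sum[OF lin] linear_scale[OF lin])
      finally show "h' (f p) (f' p v) = (\<Sum>b\<in>Basis. (f' p v \<bullet> b) *\<^sub>R h' (f p) b)" .
    qed
    finally show "((\<lambda>p. h (f p)) has_derivative (\<lambda>v. \<Sum>b\<in>Basis. (f' p v \<bullet> b) *\<^sub>R h' (f p) b)) (at p)" .
  next
    fix v
    show "Ck_on n U (\<lambda>p. \<Sum>b\<in>Basis. (f' p v \<bullet> b) *\<^sub>R h' (f p) b)"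
      by (rule Ck_on_sum[OF assms(1) Ck_on_bilinear[OF assms(1) bounded_bilinear_scaleR
          Ck_on_linear_compose[OF assms(1) f'(2) bounded_linear_inner_left]
          Suc.IH[OF h'(2) Suc.prems(2)[THEN Ck_on_Suc_imp] Suc.prems(3)]]])
  qed fact
qed

lemma smooth_on_Ck: "smooth_on U f \<Longrightarrow> Ck_on n U f"
  by (simp add: smooth_on_def)

lemma smooth_on_cong:
  assumes "open U" "\<And>p. p \<in> U \<Longrightarrow> f p = g p" "smooth_on U f"
  shows "smooth_on U g"
  using assms Ck_on_cong unfolding smooth_on_def by blast

lemma smooth_on_imp_continuous_on: "smooth_on U f \<Longrightarrow> continuous_on U f"
  using Ck_on_imp_continuous_on unfolding smooth_on_def by blast

lemma smooth_on_has_derivative: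
  "smooth_on U f \<Longrightarrow> p \<in> U \<Longrightarrow> (f has_derivative frechet_derivative f (at p)) (at p)"
  using smooth_on_Ck[of U f 1] by (auto simp: frechet_derivative_works)

lemma smooth_on_frechet_derivative:
  "smooth_on U f \<Longrightarrow> smooth_on U (\<lambda>p. frechet_derivative f (at p) v)"
  unfolding smooth_on_def by (metis Ck_on.simps(2))

text \<open>Bootstrapping: if f' is expressed through f itself, each order of smoothness of f yields
  the next, and differentiability supplies the continuous start. It serves \<open>inverse\<close>,
  \<open>sqrt\<close> and implicitly defined functions.\<close>

lemma smooth_on_SucI:
  assumes "open U" "\<And>p. p \<in> U \<Longrightarrow> (f has_derivative f' p) (at p)"
    "\<And>n v. Ck_on n U f \<Longrightarrow> Ck_on n U (\<lambda>p. f' p v)"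
  shows "smooth_on U f"
proof -
  have "continuous_on U f"
    using assms(2) by (meson continuous_at_imp_continuous_on has_derivative_continuous)
  then have "Ck_on n U f" for n
    by (induction n) (simp, blast intro: Ck_on_SucI[OF assms(1,2)] assms(3))
  then show ?thesis by (simp add: smooth_on_def)
qed

lemma smooth_on_const: "smooth_on U (\<lambda>p. c)"
  by (simp add: smooth_on_def Ck_on_const)

lemma smooth_on_bounded_linear: "bounded_linear f \<Longrightarrow> smooth_on U f"
  by (meson Ck_on_bounded_linear Ck_on_subset smooth_on_def top_greatest)

lemma smooth_on_ident: "smooth_on U (\<lambda>p. p)"
  by (intro smooth_on_bounded_linear bounded_linear_ident)

lemma smooth_on_compose:
  fixes h :: "'b::euclidean_space \<Rightarrow> 'c::real_normed_vector"
  assumes "smooth_on V h" "open V" "open U" "smooth_on U f" "\<And>p. p \<in> U \<Longrightarrow> f p \<in> V"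
  shows "smooth_on U (\<lambda>p. h (f p))"
  using Ck_on_compose[OF assms(3,2)] assms unfolding smooth_on_def by blast

lemma smooth_on_Pair:
  "open U \<Longrightarrow> smooth_on U f \<Longrightarrow> smooth_on U g \<Longrightarrow> smooth_on U (\<lambda>p. (f p, g p))"
  using Ck_on_Pair unfolding smooth_on_def by blast

lemma smooth_on_linear_compose:
  "bounded_linear h \<Longrightarrow> open U \<Longrightarrow> smooth_on U f \<Longrightarrow> smooth_on U (\<lambda>p. h (f p))"
  using Ck_on_linear_compose unfolding smooth_on_def by blast

lemmas smooth_on_fst = smooth_on_linear_compose[OF bounded_linear_fst]
  and smooth_on_snd = smooth_on_linear_compose[OF bounded_linear_snd]
  and smooth_on_uminus = smooth_on_linear_compose[OF bounded_linear_minus[OF bounded_linear_ident]]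
  and smooth_on_of_real = smooth_on_linear_compose[OF bounded_linear_of_real]

lemma smooth_on_add:
  "open U \<Longrightarrow> smooth_on U f \<Longrightarrow> smooth_on U g \<Longrightarrow> smooth_on U (\<lambda>p. f p + g p)"
  using Ck_on_add unfolding smooth_on_def by blast

lemma smooth_on_diff:
  "open U \<Longrightarrow> smooth_on U f \<Longrightarrow> smooth_on U g \<Longrightarrow> smooth_on U (\<lambda>p. f p - g p)"
  using smooth_on_add[OF _ _ smooth_on_uminus] by simp

lemma smooth_on_mult:
  fixes f g :: "'a::real_normed_vector \<Rightarrow> 'b::real_normed_algebra"
  shows "open U \<Longrightarrow> smooth_on U f \<Longrightarrow> smooth_on U g \<Longrightarrow> smooth_on U (\<lambda>p. f p * g p)"
  using Ck_on_bilinear[OF _ bounded_bilinear_mult] unfolding smooth_on_def by blast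

lemma smooth_on_power:
  fixes f :: "'a::real_normed_vector \<Rightarrow> 'b::real_normed_algebra_1"
  shows "open U \<Longrightarrow> smooth_on U f \<Longrightarrow> smooth_on U (\<lambda>p. f p ^ n)"
  by (induction n) (simp_all add: smooth_on_const smooth_on_mult)

lemma smooth_on_sin_cos_real: "smooth_on UNIV (sin :: real \<Rightarrow> real)" "smooth_on UNIV (cos :: real \<Rightarrow> real)"
proof -
  \<comment> \<open>Each function is the derivative of the other up to sign, so the induction
    carries both.\<close>
  have "Ck_on n UNIV (sin :: real \<Rightarrow> real) \<and> Ck_on n UNIV (cos :: real \<Rightarrow> real)" for n
  proof (induction n)
    case 0
    show ?case by (auto intro: continuous_intros)
  next
    case (Suc n)
    have "Ck_on n UNIV (\<lambda>x::real. v * cos x)" "Ck_on n UNIV (\<lambda>x::real. - (v * sin x))" for v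
      using Suc Ck_on_linear_compose[of UNIV n cos "\<lambda>y. v * y"] Ck_on_linear_compose[of UNIV n sin "\<lambda>y. - (v * y)"]
      by (auto intro!: bounded_linear_mult_right bounded_linear_minus)
    then show ?case
      by (intro conjI Ck_on_SucI[of UNIV sin "\<lambda>x v. v * cos x"] Ck_on_SucI[of UNIV cos "\<lambda>x v. - (v * sin x)"])
        (auto intro!: derivative_eq_intros simp: fun_eq_iff)
  qed
  then show "smooth_on UNIV (sin :: real \<Rightarrow> real)" "smooth_on UNIV (cos :: real \<Rightarrow> real)"
    by (auto simp: smooth_on_def)
qed

lemma Ck_on_mult:
  fixes f g :: "'a::real_normed_vector \<Rightarrow> 'b::real_normed_algebra"
  shows "open U \<Longrightarrow> Ck_on n U f \<Longrightarrow> Ck_on n U g \<Longrightarrow> Ck_on n U (\<lambda>p. f p * g p)"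
  by (rule Ck_on_bilinear[OF _ bounded_bilinear_mult])

lemma smooth_on_inverse_real: "smooth_on (- {0}) (inverse :: real \<Rightarrow> real)"
proof (rule smooth_on_SucI[where f'="\<lambda>x v. - (inverse x * v * inverse x)"])
  fix n and v :: real
  assume *: "Ck_on n (- {0}) (inverse :: real \<Rightarrow> real)"
  show "Ck_on n (- {0}) (\<lambda>x::real. - (inverse x * v * inverse x))"
    using Ck_on_mult[OF _ Ck_on_mult[OF _ Ck_on_const[of n "- {0}" "-v"] *] *]
    by (simp add: open_Compl mult_ac)
qed (auto intro: has_derivative_inverse' simp: open_Compl)

lemma smooth_on_inverse:
  fixes f :: "'a::real_normed_vector \<Rightarrow> real"
  assumes "open U" "smooth_on U f" "\<And>p. p \<in> U \<Longrightarrow> f p \<noteq> 0"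
  shows "smooth_on U (\<lambda>p. inverse (f p))"
  by (rule smooth_on_compose[OF smooth_on_inverse_real]) (use assms in auto)

lemma smooth_on_divide:
  fixes f g :: "'a::real_normed_vector \<Rightarrow> real"
  assumes "open U" "smooth_on U f" "smooth_on U g" "\<And>p. p \<in> U \<Longrightarrow> g p \<noteq> 0"
  shows "smooth_on U (\<lambda>p. f p / g p)"
  unfolding divide_inverse by (intro smooth_on_mult smooth_on_inverse assms)

lemma smooth_on_sqrt_real: "smooth_on {0<..} sqrt"
proof (rule smooth_on_SucI[where f'="\<lambda>x v. v * (inverse (sqrt x) / 2)"])
  fix n and v :: real
  assume *: "Ck_on n {0<..} sqrt"
  have "Ck_on n {0<..} (\<lambda>x. inverse (sqrt x))"
    by (rule Ck_on_compose[OF _ _ smooth_on_Ck[OF smooth_on_inverse_real] *]) auto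
  from Ck_on_mult[OF _ Ck_on_const[of n "{0<..}" "v/2"] this]
  show "Ck_on n {0<..} (\<lambda>x. v * (inverse (sqrt x) / 2))"
    by (simp add: mult_ac)
qed (auto intro!: derivative_eq_intros simp: fun_eq_iff)

lemma smooth_on_sqrt:
  assumes "open U" "smooth_on U f" "\<And>p. p \<in> U \<Longrightarrow> f p > 0"
  shows "smooth_on U (\<lambda>p. sqrt (f p))"
  by (rule smooth_on_compose[OF smooth_on_sqrt_real]) (use assms in auto)

lemma smooth_on_sin:
  fixes f :: "'a::real_normed_vector \<Rightarrow> real"
  shows "open U \<Longrightarrow> smooth_on U f \<Longrightarrow> smooth_on U (\<lambda>p. sin (f p))"
  by (rule smooth_on_compose[OF smooth_on_sin_cos_real(1)]) auto

lemma smooth_on_cos: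
  fixes f :: "'a::real_normed_vector \<Rightarrow> real"
  shows "open U \<Longrightarrow> smooth_on U f \<Longrightarrow> smooth_on U (\<lambda>p. cos (f p))"
  by (rule smooth_on_compose[OF smooth_on_sin_cos_real(2)]) auto

lemmas smooth_on_intros = smooth_on_const smooth_on_ident smooth_on_Pair smooth_on_fst smooth_on_snd
  smooth_on_uminus smooth_on_of_real smooth_on_add smooth_on_diff smooth_on_mult smooth_on_power
  smooth_on_divide smooth_on_sqrt smooth_on_sin smooth_on_cos

text \<open>Differentiation under the integral sign. The variable t ranges over the whole line so
  that the total derivative of f makes sense at the ends of {a..b} as well.\<close>

lemma has_derivative_integral_param:
  fixes f :: "'a::euclidean_space \<times> real \<Rightarrow> 'b::banach"
  assumes "open U"
    and der: "\<And>p t. p \<in> U \<Longrightarrow> (f has_derivative f' (p, t)) (at (p, t))"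
    and cont: "\<And>v. continuous_on (U \<times> UNIV) (\<lambda>q. f' q v)"
    and "p \<in> U"
  shows "((\<lambda>p. integral {a..b} (\<lambda>t. f (p, t))) has_derivative
    (\<lambda>v. integral {a..b} (\<lambda>t. f' (p, t) (v, 0)))) (at p)"
proof -
  define F where "F = (\<lambda>p t. Blinfun (\<lambda>v. f' (p, t) (v, 0)))"
  obtain e where e: "e > 0" "ball p e \<subseteq> U" using assms(1,4) openE by blast
  have part: "((\<lambda>p. f (p, t)) has_derivative (\<lambda>v. f' (q, t) (v, 0))) (at q within A)" if "q \<in> U" for q t A
    by (rule has_derivative_compose[of "\<lambda>p. (p, t)" "\<lambda>v. (v, 0)", OF _ der[OF that]])
      (auto intro!: derivative_eq_intros)
  have F: "blinfun_apply (F q t) v = f' (q, t) (v, 0)" if "q \<in> U" for q t v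
    unfolding F_def
    by (subst bounded_linear_Blinfun_apply[OF has_derivative_bounded_linear[OF part[OF that]]]) auto
  \<comment> \<open>Leibniz' rule asks for continuity in the operator norm; since the parameter
    space is finite-dimensional, continuity at each basis vector suffices.\<close>
  have contF: "continuous_on (ball p e \<times> cbox a b) (\<lambda>(q, t). F q t)"
  proof (rule continuous_on_blinfun_componentwise)
    fix i :: 'a
    have "continuous_on (ball p e \<times> cbox a b) (\<lambda>q. f' q (i, 0))"
      by (rule continuous_on_subset[OF cont]) (use e in auto)
    then show "continuous_on (ball p e \<times> cbox a b) (\<lambda>x. blinfun_apply (case x of (q, t) \<Rightarrow> F q t) i)"
      by (rule continuous_on_eq) (use F e in auto)
  qed
  have contf: "continuous_on (U \<times> UNIV) f"
    using der by (intro continuous_at_imp_continuous_on) (auto intro: has_derivative_continuous)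
  have "((\<lambda>p. integral (cbox a b) (\<lambda>t. f (p, t))) has_derivative
      integral (cbox a b) (F p)) (at p within ball p e)"
  proof (rule leibniz_rule[OF _ _ contF])
    fix q t assume q: "q \<in> ball p e" 
    then have "q \<in> U" using e by auto
    have "blinfun_apply (F q t) = (\<lambda>v. f' (q, t) (v, 0))" using F[OF \<open>q \<in> U\<close>] by auto
    then show "((\<lambda>p. f (p, t)) has_derivative blinfun_apply (F q t)) (at q within ball p e)"
      using part[OF \<open>q \<in> U\<close>] by simp
    have "continuous_on (cbox a b) (\<lambda>t. f (q, t))"
      by (rule continuous_on_compose2[OF contf]) (use \<open>q \<in> U\<close> in \<open>auto intro!: continuous_intros\<close>)
    then show "(\<lambda>t. f (q, t)) integrable_on cbox a b" by (rule integrable_continuous)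
  qed (use e in auto)
  moreover have "blinfun_apply (integral (cbox a b) (F p)) = (\<lambda>v. integral {a..b} (\<lambda>t. f' (p, t) (v, 0)))"
  proof
    fix v
    have "Pair p ` cbox a b \<subseteq> ball p e \<times> cbox a b" using e by auto
    from continuous_on_compose2[OF contF continuous_on_Pair[OF continuous_on_const continuous_on_id] this]
    have "continuous_on (cbox a b) (F p)" by simp
    then have "F p integrable_on cbox a b" by (rule integrable_continuous)
    from blinfun_apply_integral[OF this, of v]
    show "blinfun_apply (integral (cbox a b) (F p)) v = integral {a..b} (\<lambda>t. f' (p, t) (v, 0))"
      using F[OF assms(4)] by simp
  qed
  ultimately show ?thesis
    using e at_within_open[of p "ball p e"] by (simp add: cbox_interval)
qed

lemma Ck_on_integral_param:
  fixes f :: "'a::euclidean_space \<times> real \<Rightarrow> 'b::banach"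
  assumes "open U" "Ck_on n (U \<times> UNIV) f"
  shows "Ck_on n U (\<lambda>p. integral {a..b} (\<lambda>t. f (p, t)))"
  using assms(2)
proof (induction n arbitrary: f)
  case 0
  have "continuous_on U (\<lambda>p. integral (cbox a b) (\<lambda>t. f (p, t)))"
    by (rule integral_continuous_on_param) (use 0 in \<open>auto intro: continuous_on_subset\<close>)
  then show ?case by (simp add: cbox_interval)
next
  case (Suc n)
  obtain f' where f': "\<And>p. p \<in> U \<times> UNIV \<Longrightarrow> (f has_derivative f' p) (at p)"
    "\<And>v. Ck_on n (U \<times> UNIV) (\<lambda>p. f' p v)"
    using Ck_on_SucD[OF Suc.prems] by blast
  have "((\<lambda>p. integral {a..b} (\<lambda>t. f (p, t))) has_derivative
    (\<lambda>v. integral {a..b} (\<lambda>t. f' (p, t) (v, 0)))) (at p)" if "p \<in> U" for p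
    by (rule has_derivative_integral_param[OF assms(1) _ Ck_on_imp_continuous_on[OF f'(2)] that])
      (simp add: f'(1))
  from Ck_on_SucI[OF assms(1) this Suc.IH[OF f'(2)]] show ?case .
qed

lemma smooth_on_integral_param:
  fixes f :: "'a::euclidean_space \<times> real \<Rightarrow> 'b::banach"
  assumes "open U" "smooth_on (U \<times> UNIV) f"
  shows "smooth_on U (\<lambda>p. integral {a..b} (\<lambda>t. f (p, t)))"
  using assms Ck_on_integral_param unfolding smooth_on_def by blast

text \<open>The map \<Phi> (p, y) = (p, H (p, y)) flattens the zero set of H. It is injective on V,
  its inverse \<Psi> sends (p, 0) to (p, g p), and the inverse function theorem differentiates
  \<Psi>. Injectivity is assumed on all of V, so no neighbourhood has to be shrunk.\<close>

lemma has_derivative_implicit: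
  fixes H :: "'a::euclidean_space \<times> real \<Rightarrow> real" and g :: "'a \<Rightarrow> real"
  assumes "open U" "open V" "smooth_on V H"
    and inj: "\<And>p y z. (p, y) \<in> V \<Longrightarrow> (p, z) \<in> V \<Longrightarrow> H (p, y) = H (p, z) \<Longrightarrow> y = z"
    and gV: "\<And>p. p \<in> U \<Longrightarrow> (p, g p) \<in> V" and g0: "\<And>p. p \<in> U \<Longrightarrow> H (p, g p) = 0"
    and nz: "\<And>q. q \<in> V \<Longrightarrow> frechet_derivative H (at q) (0, 1) \<noteq> 0"
    and "p \<in> U"
  shows "(g has_derivative (\<lambda>v. - frechet_derivative H (at (p, g p)) (v, 0) /
            frechet_derivative H (at (p, g p)) (0, 1))) (at p)"
proof -
  define \<Phi> where "\<Phi> = (\<lambda>q. (fst q, H q))"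
  define \<Psi> where "\<Psi> = inv_into V \<Phi>"
  define H' where "H' = frechet_derivative H (at (p, g p))"
  have H': "(H has_derivative H') (at (p, g p))"
    unfolding H'_def using smooth_on_has_derivative[OF assms(3) gV[OF \<open>p \<in> U\<close>]] .
  have nz': "H' (0, 1) \<noteq> 0" using nz gV \<open>p \<in> U\<close> unfolding H'_def by blast
  have "inj_on \<Phi> V" using inj by (auto simp: inj_on_def \<Phi>_def)
  then have \<Psi>: "\<Psi> (\<Phi> q) = q" if "q \<in> V" for q unfolding \<Psi>_def using that by simp
  have lin: "H' (v, r) = H' (v, 0) + r * H' (0, 1)" for v r
  proof -
    have l: "linear H'" using H' has_derivative_linear by blast
    have "H' (v, r) = H' ((v, 0) + r *\<^sub>R (0, 1))" by simp
    then show ?thesis by (simp only: linear_add[OF l] linear_scale[OF l] real_scaleR_def)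
  qed
  have der\<Psi>: "(\<Psi> has_derivative (\<lambda>w. (fst w, (snd w - H' (fst w, 0)) / H' (0, 1)))) (at (\<Phi> (p, g p)))"
  proof (rule has_derivative_inverse_strong[where S=V and f=\<Phi>])
    show "continuous_on V \<Phi>"
      unfolding \<Phi>_def by (intro continuous_intros smooth_on_imp_continuous_on assms)
    show "(\<Phi> has_derivative (\<lambda>w. (fst w, H' w))) (at (p, g p))"
      unfolding \<Phi>_def by (intro derivative_intros H')
    show "(\<lambda>w. (fst w, H' w)) \<circ> (\<lambda>w. (fst w, (snd w - H' (fst w, 0)) / H' (0, 1))) = id"
    proof
      fix w :: "'a \<times> real"
      show "((\<lambda>w. (fst w, H' w)) \<circ> (\<lambda>w. (fst w, (snd w - H' (fst w, 0)) / H' (0, 1)))) w = id w"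
        using nz' by (simp add: lin[of "fst w" "(snd w - H' (fst w, 0)) / H' (0, 1)"])
    qed
  qed (use assms \<Psi> in auto)
  have "((\<lambda>x. (x, 0::real)) has_derivative (\<lambda>v. (v, 0))) (at p)"
    by (auto intro!: derivative_eq_intros)
  from has_derivative_snd[OF has_derivative_compose[OF this der\<Psi>[unfolded \<Phi>_def fst_conv g0[OF \<open>p \<in> U\<close>]]]]
  have "((\<lambda>x. snd (\<Psi> (x, 0))) has_derivative (\<lambda>v. (0 - H' (v, 0)) / H' (0, 1))) (at p)"
    by simp
  then have "(g has_derivative (\<lambda>v. (0 - H' (v, 0)) / H' (0, 1))) (at p)"
  proof (rule has_derivative_transform_within_open[OF _ \<open>open U\<close> \<open>p \<in> U\<close>])
    fix x assume "x \<in> U"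
    then show "snd (\<Psi> (x, 0)) = g x" using \<Psi>[OF gV[OF \<open>x \<in> U\<close>]] g0 by (simp add: \<Phi>_def)
  qed
  then show ?thesis by (simp add: H'_def)
qed

text \<open>The formula in \<open>has_derivative_implicit\<close> is a smooth function of (p, g p),
  so \<open>smooth_on_SucI\<close> lifts g from each order to the next. It is applied to the
  amplitude and to the inverse of \<open>wave_freq\<close>.\<close>

lemma smooth_on_implicit:
  fixes H :: "'a::euclidean_space \<times> real \<Rightarrow> real" and g :: "'a \<Rightarrow> real"
  assumes "open U" "open V" "smooth_on V H"
    and "\<And>p y z. (p, y) \<in> V \<Longrightarrow> (p, z) \<in> V \<Longrightarrow> H (p, y) = H (p, z) \<Longrightarrow> y = z"
    and gV: "\<And>p. p \<in> U \<Longrightarrow> (p, g p) \<in> V" and "\<And>p. p \<in> U \<Longrightarrow> H (p, g p) = 0"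
    and nz: "\<And>q. q \<in> V \<Longrightarrow> frechet_derivative H (at q) (0, 1) \<noteq> 0"
  shows "smooth_on U g"
proof (rule smooth_on_SucI[OF assms(1) has_derivative_implicit[OF assms]])
  fix n v
  assume "Ck_on n U g"
  then have *: "Ck_on n U (\<lambda>p. (p, g p))"
    by (intro Ck_on_Pair[OF assms(1) smooth_on_Ck[OF smooth_on_ident]])
  let ?q = "\<lambda>q. - frechet_derivative H (at q) (v, 0) / frechet_derivative H (at q) (0, 1)"
  have "smooth_on V ?q"
    by (intro smooth_on_intros smooth_on_frechet_derivative assms)
  then show "Ck_on n U (\<lambda>p. ?q (p, g p))"
    using gV by (intro Ck_on_compose[OF assms(1,2) _ *] smooth_on_Ck) auto
qed

subsection \<open>Elliptic integrals and the amplitude\<close>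

lemma has_real_derivative_partial:
  fixes f :: "real \<times> real \<Rightarrow> real"
  assumes "(f has_derivative f') (at (a, b))"
  shows "((\<lambda>x. f (x, b)) has_real_derivative f' (1, 0)) (at a)"
    and "((\<lambda>y. f (a, y)) has_real_derivative f' (0, 1)) (at b)"
proof -
  have lin: "linear f'" using assms has_derivative_linear by blast
  have 1: "(\<lambda>h. f' (h, 0)) = (*) (f' (1, 0))"
  proof
    fix h show "f' (h, 0) = f' (1, 0) * h"
      using linear_scale[OF lin, of h "(1, 0)"] by (simp add: mult.commute)
  qed
  have 2: "(\<lambda>h. f' (0, h)) = (*) (f' (0, 1))"
  proof
    fix h show "f' (0, h) = f' (0, 1) * h"
      using linear_scale[OF lin, of h "(0, 1)"] by (simp add: mult.commute)
  qed
  have "((\<lambda>x. f (x, b)) has_derivative (\<lambda>h. f' (h, 0))) (at a)"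
    by (rule has_derivative_compose[of "\<lambda>x. (x, b)" "\<lambda>h. (h, 0)", OF _ assms]) (auto intro!: derivative_eq_intros)
  then show "((\<lambda>x. f (x, b)) has_real_derivative f' (1, 0)) (at a)"
    unfolding has_field_derivative_def 1 .
  have "((\<lambda>y. f (a, y)) has_derivative (\<lambda>h. f' (0, h))) (at b)"
    by (rule has_derivative_compose[of "\<lambda>y. (a, y)" "\<lambda>h. (0, h)", OF _ assms]) (auto intro!: derivative_eq_intros)
  then show "((\<lambda>y. f (a, y)) has_real_derivative f' (0, 1)) (at b)"
    unfolding has_field_derivative_def 2 .
qed

text \<open>This is \<open>elliptic_F\<close> with k^2 replaced by a free real m, and with paired
  arguments so that joint smoothness can be expressed.\<close>

definition ellF :: "real \<times> real \<Rightarrow> real" where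
  "ellF = (\<lambda>(m, \<theta>). LBINT s=0..ereal \<theta>. 1 / sqrt (1 - m * (sin s)\<^sup>2))"

definition ellK :: "real \<Rightarrow> real" where
  "ellK m = ellF (m, pi / 2)"

definition ell_am :: "real \<times> real \<Rightarrow> real" where
  "ell_am = (\<lambda>(m, u). THE \<theta>. ellF (m, \<theta>) = u)"

lemma jacobi_am_eq: "jacobi_am u k = ell_am (k\<^sup>2, u)"
  by (simp add: jacobi_am_def ell_am_def ellF_def elliptic_F_def)

lemma one_minus_mult_sin_squared_pos: "m < 1 \<Longrightarrow> 0 < 1 - m * (sin s)\<^sup>2" for m s :: real
proof -
  assume "m < 1"
  have s: "0 \<le> (sin s)\<^sup>2" "(sin s)\<^sup>2 \<le> 1" by (auto simp: abs_square_le_1)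
  show ?thesis
  proof (cases "m \<le> 0")
    case True
    then have "m * (sin s)\<^sup>2 \<le> 0" using s by (simp add: mult_nonpos_nonneg)
    then show ?thesis by simp
  next
    case False
    then have "m * (sin s)\<^sup>2 \<le> m * 1" using s by (intro mult_left_mono) auto
    then show ?thesis using \<open>m < 1\<close> by simp
  qed
qed

lemma mult_sin_squared_less_1:
  fixes m s :: real
  assumes "m < 1"
  shows "m * (sin s)\<^sup>2 < 1" "m * (sin s)\<^sup>2 \<noteq> 1"
  using one_minus_mult_sin_squared_pos[OF assms, of s] by auto

lemma continuous_on_ellF_integrand:
  "m < 1 \<Longrightarrow> continuous_on A (\<lambda>s. 1 / sqrt (1 - m * (sin s)\<^sup>2))" for m :: real
  using one_minus_mult_sin_squared_pos by (intro continuous_intros) (metis less_irrefl real_sqrt_eq_0_iff)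

text \<open>Rescaling s = \<theta> t moves \<theta> from the limit of integration into the
  integrand, whatever its sign. Over the fixed interval {0..1}, smoothness in (m, \<theta>) becomes
  smoothness of a parameter integral.\<close>

lemma ellF_eq_integral:
  assumes "m < 1"
  shows "ellF (m, \<theta>) = integral {0..1} (\<lambda>t. \<theta> / sqrt (1 - m * (sin (\<theta> * t))\<^sup>2))"
proof -
  let ?f = "\<lambda>s. 1 / sqrt (1 - m * (sin s)\<^sup>2)"
  have c: "continuous_on A (\<lambda>t. ?f (\<theta> * t))" for A
    by (rule continuous_on_compose2[OF continuous_on_ellF_integrand[OF assms, of UNIV]])
       (auto intro!: continuous_intros)
  have "ellF (m, \<theta>) = (LBINT y=ereal (\<theta> * 0)..ereal (\<theta> * 1). ?f y)"
    by (simp add: ellF_def zero_ereal_def)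
  also have "\<dots> = (LBINT t=ereal 0..ereal 1. \<theta> *\<^sub>R ?f (\<theta> * t))"
    by (rule interval_integral_substitution_finite[symmetric])
      (auto intro!: derivative_eq_intros continuous_on_ellF_integrand assms)
  also have "\<dots> = integral {0..1} (\<lambda>t. \<theta> *\<^sub>R ?f (\<theta> * t))"
    by (rule interval_integral_eq_integral) (use continuous_on_mult_left[OF c[of "{0..1}"], of \<theta>] in \<open>auto intro!: borel_integrable_atLeastAtMost'\<close>)
  finally show ?thesis by simp
qed

lemma smooth_on_ellF: "smooth_on ({..<1} \<times> UNIV) ellF"
proof -
  have o: "open ({..<1::real} \<times> (UNIV :: real set))" "open (({..<1::real} \<times> (UNIV :: real set)) \<times> (UNIV :: real set))"
    by (simp_all add: open_Times)
  have "smooth_on ({..<1} \<times> UNIV) (\<lambda>p. integral {0..1} (\<lambda>t. (\<lambda>q. snd (fst q) / sqrt (1 - fst (fst q) * (sin (snd (fst q) * snd q))\<^sup>2)) (p, t)))"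
    by (rule smooth_on_integral_param[OF o(1)]; intro smooth_on_intros o)
      (auto simp: mult_sin_squared_less_1)
  then show ?thesis
    by (rule smooth_on_cong[OF o(1), rotated]) (auto simp: ellF_eq_integral)
qed

lemma has_real_derivative_ellF:
  assumes "m < 1"
  shows "((\<lambda>\<theta>. ellF (m, \<theta>)) has_real_derivative 1 / sqrt (1 - m * (sin \<theta>)\<^sup>2)) (at \<theta>)"
proof -
  \<comment> \<open>A compact interval that contains 0 and has \<theta> in its interior, so that the
    derivative within it is the full derivative.\<close>
  let ?I = "{- \<bar>\<theta>\<bar> - 1..\<bar>\<theta>\<bar> + 1}"
  have "((\<lambda>u. LBINT y=ereal 0..ereal u. 1 / sqrt (1 - m * (sin y)\<^sup>2)) has_vector_derivative
      1 / sqrt (1 - m * (sin \<theta>)\<^sup>2)) (at \<theta> within ?I)"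
    by (rule interval_integral_FTC2) (auto intro!: continuous_on_ellF_integrand assms)
  moreover have "at \<theta> within ?I = at \<theta>"
    by (rule at_within_interior) auto
  ultimately show ?thesis
    by (simp add: ellF_def has_real_derivative_iff_has_vector_derivative zero_ereal_def)
qed

lemma ellF_0 [simp]: "ellF (m, 0) = 0"
  by (simp add: ellF_def zero_ereal_def)

lemma ellF_strict_mono: "m < 1 \<Longrightarrow> \<theta> < \<eta> \<Longrightarrow> ellF (m, \<theta>) < ellF (m, \<eta>)"
proof (rule DERIV_pos_imp_increasing[of \<theta> \<eta> "\<lambda>t. ellF (m, t)"])
  fix x assume m: "m < 1"
  show "\<exists>y. ((\<lambda>t. ellF (m, t)) has_real_derivative y) (at x) \<and> 0 < y"
    using has_real_derivative_ellF[OF m, of x] one_minus_mult_sin_squared_pos[OF m, of x]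
    by (intro exI[of _ "1 / sqrt (1 - m * (sin x)\<^sup>2)"]) simp
qed

lemma ellF_inj: "m < 1 \<Longrightarrow> ellF (m, \<theta>) = ellF (m, \<eta>) \<Longrightarrow> \<theta> = \<eta>"
  using ellF_strict_mono[of m \<theta> \<eta>] ellF_strict_mono[of m \<eta> \<theta>] by (cases \<theta> \<eta> rule: linorder_cases) auto

lemma ellF_minus:
  assumes "m < 1" shows "ellF (m, - \<theta>) = - ellF (m, \<theta>)"
proof -
  have "((\<lambda>t. ellF (m, - t) + ellF (m, t)) has_real_derivative 0) (at x)" for x
    using DERIV_add[OF DERIV_chain2[of "\<lambda>\<theta>. ellF (m, \<theta>)", OF has_real_derivative_ellF[OF assms] DERIV_minus[OF DERIV_ident]]
      has_real_derivative_ellF[OF assms, of x]] by simp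
  then have "ellF (m, - \<theta>) + ellF (m, \<theta>) = ellF (m, - 0) + ellF (m, 0)"
    using DERIV_isconst_all[of "\<lambda>t. ellF (m, - t) + ellF (m, t)" \<theta> 0] by blast
  then show ?thesis by simp
qed

text \<open>The integrand has period pi, so the difference is constant in \<theta>; at \<theta> = -
  pi / 2 oddness evaluates it to twice the quarter-period integral.\<close>

lemma ellF_plus_pi:
  assumes "m < 1" shows "ellF (m, \<theta> + pi) = ellF (m, \<theta>) + 2 * ellK m"
proof -
  have "((\<lambda>t. ellF (m, t + pi) - ellF (m, t)) has_real_derivative 0) (at x)" for x
    using DERIV_diff[OF DERIV_chain2[of "\<lambda>\<theta>. ellF (m, \<theta>)", OF has_real_derivative_ellF[OF assms] DERIV_add[OF DERIV_ident DERIV_const]]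
      has_real_derivative_ellF[OF assms, of x], of pi] by simp
  then have "ellF (m, \<theta> + pi) - ellF (m, \<theta>) = ellF (m, - (pi / 2) + pi) - ellF (m, - (pi / 2))"
    using DERIV_isconst_all[of "\<lambda>t. ellF (m, t + pi) - ellF (m, t)" \<theta> "- (pi / 2)"] by blast
  also have "- (pi / 2) + pi = pi / 2" by simp
  also have "ellF (m, pi / 2) - ellF (m, - (pi / 2)) = 2 * ellK m"
    using ellF_minus[OF assms] by (simp add: ellK_def)
  finally show ?thesis by simp
qed

lemma ellF_of_nat_pi: "m < 1 \<Longrightarrow> ellF (m, of_nat n * pi) = 2 * of_nat n * ellK m"
proof (induction n)
  case (Suc n)
  have "of_nat (Suc n) * pi = of_nat n * pi + pi" by (simp add: distrib_right)
  then show ?case using Suc ellF_plus_pi[of m "of_nat n * pi"] by (simp only:) (simp add: algebra_simps)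
qed simp

lemma ellK_pos: "m < 1 \<Longrightarrow> 0 < ellK m"
  using ellF_strict_mono[of m 0 "pi / 2"] by (simp add: ellK_def)

text \<open>By \<open>ellF_of_nat_pi\<close> and oddness the values at n pi and - n pi are 2 n K and
  - 2 n K, which enclose u for large n.\<close>

lemma ellF_surj:
  assumes "m < 1" shows "\<exists>\<theta>. ellF (m, \<theta>) = u"
proof -
  obtain n :: nat where n: "\<bar>u\<bar> / (2 * ellK m) < real n" using reals_Archimedean2 by blast
  then have n': "\<bar>u\<bar> \<le> 2 * n * ellK m" using ellK_pos[OF assms] by (simp add: field_simps)
  have "\<exists>\<theta>\<ge>- (n * pi). \<theta> \<le> n * pi \<and> ellF (m, \<theta>) = u"
  proof (rule IVT')
    show "continuous_on {- (n * pi)..n * pi} (\<lambda>\<theta>. ellF (m, \<theta>))"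
      using has_real_derivative_ellF[OF assms] by (intro DERIV_continuous_on) (auto intro: has_field_derivative_at_within)
  qed (use n' ellF_of_nat_pi[OF assms, of n] ellF_minus[OF assms, of "n * pi"] in auto)
  then show ?thesis by blast
qed

lemma ellF_ell_am: "m < 1 \<Longrightarrow> ellF (m, ell_am (m, u)) = u"
  unfolding ell_am_def prod.case by (rule theI') (metis ellF_surj ellF_inj)

lemma ell_am_ellF: "m < 1 \<Longrightarrow> ell_am (m, ellF (m, \<theta>)) = \<theta>"
  using ellF_inj[OF _ ellF_ell_am] by simp

lemma ell_am_plus:
  assumes "m < 1" shows "ell_am (m, u + 2 * ellK m) = ell_am (m, u) + pi"
  using ell_am_ellF[OF assms, of "ell_am (m, u) + pi"]
  by (simp add: ellF_plus_pi[OF assms] ellF_ell_am[OF assms])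

text \<open>The amplitude is the implicit solution \<theta> of \<open>ellF\<close> (m, \<theta>) =
  u. The derivative in \<theta> is the integrand, positive for m < 1, and \<open>ellF_inj\<close>
  supplies uniqueness.\<close>

lemma smooth_on_ell_am: "smooth_on ({..<1} \<times> UNIV) ell_am"
proof (rule smooth_on_implicit[where H="\<lambda>q. ellF (fst (fst q), snd q) - snd (fst q)" and V="({..<1} \<times> UNIV) \<times> UNIV"])
  show o: "open ({..<1::real} \<times> (UNIV :: real set))" "open (({..<1::real} \<times> (UNIV :: real set)) \<times> (UNIV :: real set))"
    by (simp_all add: open_Times)
  show sm: "smooth_on (({..<1} \<times> UNIV) \<times> UNIV) (\<lambda>q. ellF (fst (fst q), snd q) - snd (fst q :: real \<times> real))"
    by (intro smooth_on_intros o smooth_on_compose[OF smooth_on_ellF]) auto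
  fix q :: "(real \<times> real) \<times> real" assume q: "q \<in> ({..<1} \<times> UNIV) \<times> UNIV"
  obtain m u \<theta> where qq: "q = ((m, u), \<theta>)" "m < 1" using q by auto
  have "((\<lambda>x. ((m, u), x)) has_derivative (\<lambda>h. (0, h))) (at \<theta>)"
    by (auto intro!: derivative_eq_intros)
  from has_derivative_compose[OF this smooth_on_has_derivative[OF sm, OF q, unfolded qq]]
  have "((\<lambda>\<theta>. ellF (m, \<theta>) - u) has_derivative (\<lambda>h. frechet_derivative (\<lambda>q. ellF (fst (fst q), snd q) - snd (fst q)) (at q) (0, h))) (at \<theta>)"
    by (simp add: qq)
  moreover have "((\<lambda>\<theta>. ellF (m, \<theta>) - u) has_derivative (*) (1 / sqrt (1 - m * (sin \<theta>)\<^sup>2))) (at \<theta>)"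
    using DERIV_diff[OF has_real_derivative_ellF[OF qq(2), of \<theta>] DERIV_const[of u]] by (simp add: has_field_derivative_def)
  ultimately have "frechet_derivative (\<lambda>q. ellF (fst (fst q), snd q) - snd (fst q)) (at q) (0, 1) = 1 / sqrt (1 - m * (sin \<theta>)\<^sup>2) * 1"
    by (rule fun_cong[OF has_derivative_unique])
  then show "frechet_derivative (\<lambda>q. ellF (fst (fst q), snd q) - snd (fst q)) (at q) (0, 1) \<noteq> 0"
    using one_minus_mult_sin_squared_pos[OF qq(2), of \<theta>] by auto
qed (auto simp: ellF_ell_am intro: ellF_inj)

text \<open>Jacobi's relation am' = dn. Smoothness guarantees that the derivative exists; its value
  follows by differentiating \<open>ellF_ell_am\<close>.\<close>

lemma has_real_derivative_ell_am:
  assumes "m < 1"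
  shows "((\<lambda>u. ell_am (m, u)) has_real_derivative sqrt (1 - m * (sin (ell_am (m, u)))\<^sup>2)) (at u)"
proof -
  have d: "((\<lambda>u. ell_am (m, u)) has_real_derivative frechet_derivative ell_am (at (m, u)) (0, 1)) (at u)" (is "(_ has_real_derivative ?d) _")
    using assms by (intro has_real_derivative_partial smooth_on_has_derivative[OF smooth_on_ell_am]) auto
  from DERIV_chain2[OF has_real_derivative_ellF[OF assms] this]
  have "((\<lambda>u. u) has_real_derivative 1 / sqrt (1 - m * (sin (ell_am (m, u)))\<^sup>2) * ?d) (at u)"
    by (simp add: ellF_ell_am assms)
  then have "1 / sqrt (1 - m * (sin (ell_am (m, u)))\<^sup>2) * ?d = 1"
    using DERIV_ident DERIV_unique by blast
  then have "?d = sqrt (1 - m * (sin (ell_am (m, u)))\<^sup>2)"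
    using one_minus_mult_sin_squared_pos[OF assms, of "ell_am (m, u)"] by (simp add: field_simps)
  then show ?thesis using d by simp
qed

text \<open>Substitution t = sin x. The integrand in t is singular at t = 1 while the transformed
  one is bounded, hence the substitution rule for nonnegative integrands on open intervals, with
  limits at the ends.\<close>

lemma elliptic_K_eq_ellK:
  assumes "\<bar>k\<bar> < 1"
  shows "elliptic_K k = ellK (k\<^sup>2)"
proof -
  let ?f = "\<lambda>t. 1 / sqrt ((1 - t\<^sup>2) * (1 - k\<^sup>2 * t\<^sup>2))"
  have k: "k\<^sup>2 < 1" using assms by (simp add: abs_square_less_1)
  have inv: "?f (sin x) * cos x = 1 / sqrt (1 - k\<^sup>2 * (sin x)\<^sup>2)" and nz: "(1 - (sin x)\<^sup>2) * (1 - k\<^sup>2 * (sin x)\<^sup>2) \<noteq> 0"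
    if "x \<in> {0<..<pi / 2}" for x
  proof -
    have "cos x > 0" using that by (intro cos_gt_zero_pi) auto
    moreover have "1 - (sin x)\<^sup>2 = (cos x)\<^sup>2" by (simp add: cos_squared_eq)
    ultimately show "?f (sin x) * cos x = 1 / sqrt (1 - k\<^sup>2 * (sin x)\<^sup>2)" 
      "(1 - (sin x)\<^sup>2) * (1 - k\<^sup>2 * (sin x)\<^sup>2) \<noteq> 0"
      using one_minus_mult_sin_squared_pos[OF k, of x] by (simp_all add: real_sqrt_mult)
  qed
  have e: "einterval 0 (ereal (pi / 2)) = {0<..<pi / 2}" by (auto simp: einterval_def)
  have "(LBINT t=0..1. ?f t) = (LBINT x=0..ereal (pi / 2). ?f (sin x) * cos x)"
  proof (rule interval_integral_substitution_nonneg(2))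
    show "((ereal \<circ> sin \<circ> real_of_ereal) \<longlongrightarrow> 0) (at_right 0)"
      unfolding zero_ereal_def
      by (auto simp: comp_def ereal_tendsto_simps(2)[symmetric] simp flip: zero_ereal_def intro!: tendsto_eq_intros)
    show "((ereal \<circ> sin \<circ> real_of_ereal) \<longlongrightarrow> 1) (at_left (ereal (pi / 2)))"
      unfolding one_ereal_def
      by (auto simp: comp_def  intro!: tendsto_eq_intros)
    show "set_integrable lborel (einterval 0 (ereal (pi / 2))) (\<lambda>x. ?f (sin x) * cos x)"
    proof -
      have "set_integrable lborel {0<..<pi / 2} (\<lambda>x. 1 / sqrt (1 - k\<^sup>2 * (sin x)\<^sup>2))"
        by (rule set_integrable_subset[OF borel_integrable_atLeastAtMost'[OF continuous_on_ellF_integrand[OF k], of 0 "pi / 2"]]) auto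
      also have "?this \<longleftrightarrow> set_integrable lborel {0<..<pi / 2} (\<lambda>x. ?f (sin x) * cos x)"
        by (rule set_integrable_cong) (simp_all only: inv)
      finally show ?thesis unfolding e .
    qed
    show "isCont ?f (sin x)" if "0 < ereal x" "ereal x < ereal (pi / 2)" for x
      using nz[of x] that by (intro continuous_intros) auto
    show "0 \<le> ?f (sin x)" if "0 < ereal x" "ereal x < ereal (pi / 2)" for x
      using one_minus_mult_sin_squared_pos[OF k, of x] by (auto intro!: mult_nonneg_nonneg simp: abs_square_le_1)
    show "0 \<le> cos x" if "0 \<le> ereal x" "ereal x \<le> ereal (pi / 2)" for x
      using that by (intro cos_ge_zero) auto
  qed (auto intro!: derivative_eq_intros)
  also have "\<dots> = (LBINT x=0..ereal (pi / 2). 1 / sqrt (1 - k\<^sup>2 * (sin x)\<^sup>2))"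
  proof (rule interval_integral_cong)
    fix x assume "x \<in> einterval (min 0 (ereal (pi / 2))) (max 0 (ereal (pi / 2)))"
    then have "x \<in> {0<..<pi / 2}" by (simp add: e min_def max_def)
    then show "?f (sin x) * cos x = 1 / sqrt (1 - k\<^sup>2 * (sin x)\<^sup>2)" by (rule inv)
  qed
  finally show ?thesis by (simp add: elliptic_K_def ellK_def ellF_def)
qed

subsection \<open>Frequency and modulus\<close>

lemma quadratic_pos: "0 < 1 - m + m\<^sup>2" for m :: real
  using sum_power2_gt_zero_iff[of "m - 1/2" "1/2"] by (simp add: power2_eq_square algebra_simps)

lemma smooth_on_ellK: "smooth_on {..<1} ellK"
proof -
  have "smooth_on {..<1} (\<lambda>m. ellF (m, pi / 2))"
    by (rule smooth_on_compose[OF smooth_on_ellF]) (auto intro!: smooth_on_intros simp: open_Times)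
  then show ?thesis by (simp add: ellK_def[abs_def])
qed

text \<open>Written over the same interval and in the same sin^2 as the integral for K, so that
  \<open>deriv_ellK_bound\<close> can combine K and K' under one integral sign.\<close>

lemma has_real_derivative_ellK:
  assumes "m < 1"
  shows "(ellK has_real_derivative
    integral {0..1} (\<lambda>t. pi / 4 * (sin (pi / 2 * t))\<^sup>2 / sqrt (1 - m * (sin (pi / 2 * t))\<^sup>2) ^ 3)) (at m)"
proof -
  let ?s = "\<lambda>t. sin (pi / 2 * t)"
  have "((\<lambda>m. integral (cbox 0 1) (\<lambda>t. pi / 2 / sqrt (1 - m * (?s t)\<^sup>2))) has_real_derivative
      integral (cbox 0 1) (\<lambda>t. pi / 4 * (?s t)\<^sup>2 / sqrt (1 - m * (?s t)\<^sup>2) ^ 3)) (at m within {..<1})"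
  proof (rule leibniz_rule_field_derivative)
    fix x t :: real assume "x \<in> {..<1}"
    then have x: "1 - x * (?s t)\<^sup>2 > 0" using one_minus_mult_sin_squared_pos by auto
    then show "((\<lambda>x. pi / 2 / sqrt (1 - x * (?s t)\<^sup>2)) has_real_derivative
        pi / 4 * (?s t)\<^sup>2 / sqrt (1 - x * (?s t)\<^sup>2) ^ 3) (at x within {..<1})"
      by (auto intro!: derivative_eq_intros simp: field_simps power3_eq_cube)
  next
    fix x :: real assume "x \<in> {..<1}"
    then show "(\<lambda>t. pi / 2 / sqrt (1 - x * (?s t)\<^sup>2)) integrable_on cbox 0 1"
      by (intro integrable_continuous continuous_intros) (auto simp: mult_sin_squared_less_1)
  next
    show "continuous_on ({..<1} \<times> cbox 0 1) (\<lambda>(x, t). pi / 4 * (?s t)\<^sup>2 / sqrt (1 - x * (?s t)\<^sup>2) ^ 3)"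
      unfolding split_beta by (intro continuous_intros) (auto simp: mult_sin_squared_less_1)
  qed (use assms in auto)
  moreover have "at m within {..<1} = at m" using assms by (intro at_within_open) auto
  ultimately have "((\<lambda>m. integral {0..1} (\<lambda>t. pi / 2 / sqrt (1 - m * (?s t)\<^sup>2))) has_real_derivative
      integral {0..1} (\<lambda>t. pi / 4 * (?s t)\<^sup>2 / sqrt (1 - m * (?s t)\<^sup>2) ^ 3)) (at m)"
    by (simp add: cbox_interval)
  then show ?thesis
    by (rule has_field_derivative_transform_within_open[of _ _ _ "{..<1}"])
      (use assms in \<open>auto simp: ellK_def ellF_eq_integral\<close>)
qed

lemma has_integral_sin_squared: "((\<lambda>t. (sin (pi / 2 * t))\<^sup>2) has_integral 1 / 2) {0..1}"
proof -
  have "((\<lambda>t. (sin (pi / 2 * t))\<^sup>2) has_integral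
      (1 / 2 - sin (pi * 1) / (2 * pi)) - (0 / 2 - sin (pi * 0) / (2 * pi))) {0..1}"
  proof (rule fundamental_theorem_of_calculus)
    fix x :: real
    have "(sin (pi / 2 * x))\<^sup>2 = 1 / 2 - cos (pi * x) / 2"
      using cos_double_sin[of "pi / 2 * x"] by (simp add: diff_divide_distrib)
    then show "((\<lambda>t. t / 2 - sin (pi * t) / (2 * pi)) has_vector_derivative (sin (pi / 2 * x))\<^sup>2) (at x within {0..1})"
      by (auto simp flip: has_real_derivative_iff_has_vector_derivative intro!: derivative_eq_intros)
  qed simp
  then show ?thesis by simp
qed

text \<open>Chebyshev's argument: the bracket \<open>(2 - m) z - (1 - 2 m)\<close> and the weight
  \<open>(1 - m z) powr (- 3 / 2)\<close> both increase in \<open>z = sin\<^sup>2\<close>, so freezing the weight at the zero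
  \<open>z\<^sub>0\<close> of the bracket only lowers the integrand.\<close>

lemma deriv_ellK_bound:
  assumes "0 < m" "m < 1"
  shows "\<exists>d. (ellK has_real_derivative d) (at m) \<and> 4 * (1 - m + m\<^sup>2) * d - (1 - 2 * m) * ellK m > 0"
proof -
  define s where "s = (\<lambda>t. sin (pi / 2 * t))"
  define r where "r = (\<lambda>z. sqrt (1 - m * z))"
  define q where "q = (\<lambda>z. (2 - m) * z - (1 - 2 * m))"
  define z0 where "z0 = (1 - 2 * m) / (2 - m)"
  define d where "d = integral {0..1} (\<lambda>t. pi / 4 * (s t)\<^sup>2 / r ((s t)\<^sup>2) ^ 3)"
  have pos: "1 - m * (s t)\<^sup>2 > 0" for t
    using one_minus_mult_sin_squared_pos[OF assms(2)] by (simp add: s_def)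
  then have rpos: "r ((s t)\<^sup>2) > 0" for t by (simp add: r_def)
  have cont: "continuous_on {0..1} s" "continuous_on {0..1} (\<lambda>t. r ((s t)\<^sup>2))"
    unfolding s_def r_def by (auto intro!: continuous_intros)
  have nz: "r ((s t)\<^sup>2) \<noteq> 0" for t using rpos[of t] by simp
  have int: "(\<lambda>t. pi / 4 * (s t)\<^sup>2 / r ((s t)\<^sup>2) ^ 3) integrable_on {0..1}"
    "(\<lambda>t. pi / 2 / r ((s t)\<^sup>2)) integrable_on {0..1}"
    "(\<lambda>t. q ((s t)\<^sup>2) / r ((s t)\<^sup>2) ^ 3) integrable_on {0..1}"
    unfolding q_def by (intro integrable_continuous_interval continuous_intros cont ballI; simp add: nz)+
  have K: "ellK m = integral {0..1} (\<lambda>t. pi / 2 / r ((s t)\<^sup>2))"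
    using assms by (simp add: ellK_def ellF_eq_integral s_def r_def)
  \<comment> \<open>For m > 1/2 the point \<open>z0\<close> is negative and not a value of sin^2, so
    positivity at \<open>z0\<close> is computed directly.\<close>
  have q0: "1 - m * z0 > 0"
  proof -
    have "1 - m * z0 = 2 * (1 - m + m\<^sup>2) / (2 - m)"
      using assms by (simp add: z0_def field_simps power2_eq_square)
    then show ?thesis using assms quadratic_pos[of m] by simp
  qed
  then have r0: "r z0 > 0" by (simp add: r_def)
  have le: "q ((s t)\<^sup>2) / r z0 ^ 3 \<le> q ((s t)\<^sup>2) / r ((s t)\<^sup>2) ^ 3" for t
  proof (cases "(s t)\<^sup>2 \<ge> z0")
    case True
    then have "q ((s t)\<^sup>2) \<ge> 0" using assms by (simp add: q_def z0_def field_simps)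
    moreover have "r ((s t)\<^sup>2) \<le> r z0" using True assms by (simp add: r_def)
    then have "r ((s t)\<^sup>2) ^ 3 \<le> r z0 ^ 3" using rpos[of t] by (intro power_mono) auto
    ultimately show ?thesis using rpos[of t] r0 by (intro divide_left_mono) auto
  next
    case False
    then have "q ((s t)\<^sup>2) \<le> 0" using assms by (simp add: q_def z0_def field_simps)
    moreover have "r z0 \<le> r ((s t)\<^sup>2)" using False assms by (simp add: r_def)
    then have "r z0 ^ 3 \<le> r ((s t)\<^sup>2) ^ 3" using r0 by (intro power_mono) auto
    ultimately show ?thesis using rpos[of t] r0 by (intro divide_left_mono_neg) auto
  qed
  have qint: "((\<lambda>t. q ((s t)\<^sup>2) / r z0 ^ 3) has_integral ((2 - m) * (1 / 2) - (1 - 2 * m)) / r z0 ^ 3) {0..1}"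
    unfolding q_def s_def
    using has_integral_divide[OF has_integral_diff[OF has_integral_mult_right[OF has_integral_sin_squared, of "2 - m"]
        has_integral_const_real[of "1 - 2 * m" 0 1]], of "r z0 ^ 3"] by simp
  \<comment> \<open>With the weight frozen only the mean 1/2 of sin^2 enters: (2 - m) / 2 - (1 - 2
    m) = 3 m / 2.\<close>
  have "0 < 3 * m / 2 / r z0 ^ 3" using assms q0 by (simp add: r_def)
  also have "\<dots> = integral {0..1} (\<lambda>t. q ((s t)\<^sup>2) / r z0 ^ 3)"
    using integral_unique[OF qint] by (simp add: field_simps)
  also have "\<dots> \<le> integral {0..1} (\<lambda>t. q ((s t)\<^sup>2) / r ((s t)\<^sup>2) ^ 3)"
    using le by (intro integral_le int has_integral_integrable[OF qint])
  finally have "0 < pi / 2 * integral {0..1} (\<lambda>t. q ((s t)\<^sup>2) / r ((s t)\<^sup>2) ^ 3)" by simp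
  also have "\<dots> = integral {0..1} (\<lambda>t. pi / 2 * (q ((s t)\<^sup>2) / r ((s t)\<^sup>2) ^ 3))"
    by (rule integral_mult_right[symmetric])
  also have "\<dots> = integral {0..1} (\<lambda>t. 4 * (1 - m + m\<^sup>2) * (pi / 4 * (s t)\<^sup>2 / r ((s t)\<^sup>2) ^ 3)
      - (1 - 2 * m) * (pi / 2 / r ((s t)\<^sup>2)))"
  proof (rule integral_cong)
    fix t
    have "1 - m * (s t)\<^sup>2 = r ((s t)\<^sup>2) ^ 2" using pos[of t] by (simp add: r_def)
    moreover have "1 / r ((s t)\<^sup>2) = r ((s t)\<^sup>2) ^ 2 / r ((s t)\<^sup>2) ^ 3"
      using nz[of t] by (simp add: power3_eq_cube power2_eq_square)
    ultimately have e: "1 / r ((s t)\<^sup>2) = (1 - m * (s t)\<^sup>2) / r ((s t)\<^sup>2) ^ 3" by simp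
    have "4 * (1 - m + m\<^sup>2) * (pi / 4 * (s t)\<^sup>2 / r ((s t)\<^sup>2) ^ 3) - (1 - 2 * m) * (pi / 2 / r ((s t)\<^sup>2))
      = 4 * (1 - m + m\<^sup>2) * (pi / 4 * (s t)\<^sup>2 / r ((s t)\<^sup>2) ^ 3) - (1 - 2 * m) * pi / 2 * (1 / r ((s t)\<^sup>2))"
      by simp
    also have "\<dots> = (pi * (1 - m + m\<^sup>2) * (s t)\<^sup>2 - (1 - 2 * m) * pi / 2 * (1 - m * (s t)\<^sup>2)) / r ((s t)\<^sup>2) ^ 3"
      unfolding e using nz[of t] by (simp add: field_simps)
    \<comment> \<open>In the coefficient of sin^2 the m^2 terms cancel, which leaves exactly the
      bracket \<open>q\<close>.\<close>
    also have "pi * (1 - m + m\<^sup>2) * (s t)\<^sup>2 - (1 - 2 * m) * pi / 2 * (1 - m * (s t)\<^sup>2) = pi / 2 * q ((s t)\<^sup>2)"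
      by (simp add: q_def field_simps power2_eq_square)
    finally show "pi / 2 * (q ((s t)\<^sup>2) / r ((s t)\<^sup>2) ^ 3) = 4 * (1 - m + m\<^sup>2) * (pi / 4 * (s t)\<^sup>2 / r ((s t)\<^sup>2) ^ 3) - (1 - 2 * m) * (pi / 2 / r ((s t)\<^sup>2))"
      by simp
  qed
  also have "\<dots> = 4 * (1 - m + m\<^sup>2) * d - (1 - 2 * m) * ellK m"
    unfolding d_def K integral_mult_right[symmetric]
    by (rule integral_diff) (intro integrable_on_mult_right int)+
  finally show ?thesis
    using has_real_derivative_ellK[OF assms(2)] unfolding d_def s_def r_def by blast
qed

section \<open>Behaviour of \<open>ellK\<close> at the two ends m = 0 and m = 1\<close>

lemma ellK_0: "ellK 0 = pi / 2"
  by (simp add: ellK_def ellF_eq_integral)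

text \<open>Logarithmic divergence of K at m = 1. For m = 1 - e^2 the radicand is e^2 + (1 - e^2)
  cos^2 x, and cos x \<le> pi/2 - x bounds its root by e + pi/2 - x, whose reciprocal integrates to
  a logarithm.\<close>

lemma ellK_ge_ln:
  assumes "0 < e" "e < 1"
  shows "ellK (1 - e\<^sup>2) \<ge> - ln e"
proof -
  let ?f = "\<lambda>x. 1 / sqrt (1 - (1 - e\<^sup>2) * (sin x)\<^sup>2)"
  have m: "1 - e\<^sup>2 < 1" using assms by simp
  have e: "e\<^sup>2 \<le> 1" using assms by (simp add: power_le_one)
  have "- ln e \<le> - ln e + ln (e + pi / 2)" using assms pi_ge_two by simp
  also have "((\<lambda>x. 1 / (e + pi / 2 - x)) has_integral - ln (e + pi / 2 - pi / 2) - (- ln (e + pi / 2 - 0))) {0..pi / 2}"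
    by (rule fundamental_theorem_of_calculus)
      (use assms in \<open>auto intro!: derivative_eq_intros simp flip: has_real_derivative_iff_has_vector_derivative\<close>)
  then have 1: "((\<lambda>x. 1 / (e + pi / 2 - x)) has_integral - ln e + ln (e + pi / 2)) {0..pi / 2}" by simp
  have 2: "(?f has_integral integral {0..pi / 2} ?f) {0..pi / 2}"
    by (intro integrable_integral integrable_continuous_interval continuous_on_ellF_integrand m)
  have "- ln e + ln (e + pi / 2) \<le> integral {0..pi / 2} ?f"
  proof (rule has_integral_le[OF 1 2])
    fix x assume x: "x \<in> {0..pi / 2}"
    let ?y = "pi / 2 - x"
    have "cos x \<le> ?y" using sin_x_le_x[of ?y] x by (simp add: sin_diff)
    moreover have "0 \<le> cos x" using x by (intro cos_ge_zero) auto
    ultimately have c: "(cos x)\<^sup>2 \<le> ?y\<^sup>2" by (intro power_mono)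
    have "1 - (1 - e\<^sup>2) * (sin x)\<^sup>2 = e\<^sup>2 + (1 - e\<^sup>2) * (cos x)\<^sup>2"
      by (simp add: sin_squared_eq algebra_simps)
    also have "\<dots> \<le> e\<^sup>2 + 1 * ?y\<^sup>2" using c e by (intro add_left_mono mult_mono) auto
    also have "\<dots> \<le> (e + ?y)\<^sup>2" using x assms by (simp add: power2_sum)
    finally have "sqrt (1 - (1 - e\<^sup>2) * (sin x)\<^sup>2) \<le> e + ?y"
      using x assms by (intro real_le_lsqrt) auto
    moreover have "0 < sqrt (1 - (1 - e\<^sup>2) * (sin x)\<^sup>2)" using one_minus_mult_sin_squared_pos[OF m] by simp
    ultimately show "1 / (e + pi / 2 - x) \<le> ?f x" using x assms by (intro divide_left_mono) (auto simp: add_diff_eq)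
  qed
  also have "integral {0..pi / 2} ?f = ellK (1 - e\<^sup>2)"
    unfolding ellK_def ellF_def prod.case
    by (subst interval_integral_eq_integral[symmetric])
      (auto simp: zero_ereal_def intro!: borel_integrable_atLeastAtMost' continuous_on_ellF_integrand m)
  finally show ?thesis using 1 assms pi_ge_two by simp
qed

text \<open>\<open>wave_freq L\<close> maps \<open>m = k\<^sup>2\<close> to \<open>\<omega>\<close>, \<open>wave_param L\<close> is its inverse, and
  \<open>root_gap \<omega> m\<close> is \<open>\<beta>\<^sub>3 - \<beta>\<^sub>1\<close>.\<close>

definition wave_freq :: "real \<Rightarrow> real \<Rightarrow> real" where
  "wave_freq L m = 16 / L\<^sup>2 * ((ellK m)\<^sup>2 * sqrt (1 - m + m\<^sup>2))"

definition wave_param :: "real \<Rightarrow> real \<Rightarrow> real" where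
  "wave_param L \<omega> = inv_into {0<..<1} (wave_freq L) \<omega>"

definition root_gap :: "real \<Rightarrow> real \<Rightarrow> real" where
  "root_gap \<omega> m = 3 * \<omega> / sqrt (1 - m + m\<^sup>2)"

lemma smooth_on_wave_freq: "smooth_on {..<1} (wave_freq L)"
proof -
  have "smooth_on {..<1} (\<lambda>m. 16 / L\<^sup>2 * ((ellK m)\<^sup>2 * sqrt (1 - m + m\<^sup>2)))"
    by (intro smooth_on_intros smooth_on_ellK quadratic_pos) auto
  then show ?thesis by (simp add: wave_freq_def[abs_def])
qed

text \<open>With S = sqrt (1 - m + m^2), the derivative of K^2 S is K / (2 S) times 4 S^2 K' - (1 -
  2 m) K; this is where the combination in \<open>deriv_ellK_bound\<close> comes from.\<close>

lemma wave_freq_deriv_pos: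
  assumes "L > 0" "0 < m" "m < 1"
  shows "\<exists>d>0. (wave_freq L has_real_derivative d) (at m)"
proof -
  obtain d where d: "(ellK has_real_derivative d) (at m)" 
    and pos: "4 * (1 - m + m\<^sup>2) * d - (1 - 2 * m) * ellK m > 0"
    using deriv_ellK_bound[OF assms(2,3)] by blast
  let ?S = "sqrt (1 - m + m\<^sup>2)"
  have S: "?S > 0" "?S\<^sup>2 = 1 - m + m\<^sup>2" using quadratic_pos[of m] by auto
  have "((\<lambda>m. (ellK m)\<^sup>2 * sqrt (1 - m + m\<^sup>2)) has_real_derivative
      2 * ellK m * d * ?S + (ellK m)\<^sup>2 * ((2 * m - 1) * (inverse ?S / 2))) (at m)"
    using quadratic_pos[of m] by (auto intro!: derivative_eq_intros d simp: algebra_simps)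
  from DERIV_cmult[OF this, of "16 / L\<^sup>2"]
  have "(wave_freq L has_real_derivative
      16 / L\<^sup>2 * (2 * ellK m * d * ?S + (ellK m)\<^sup>2 * ((2 * m - 1) * (inverse ?S / 2)))) (at m)"
    by (simp add: wave_freq_def[abs_def])
  moreover have "2 * ellK m * d * ?S + (ellK m)\<^sup>2 * ((2 * m - 1) * (inverse ?S / 2))
      = ellK m / (2 * ?S) * (4 * ?S\<^sup>2 * d - (1 - 2 * m) * ellK m)"
    using S(1) by (simp add: field_simps power2_eq_square del: real_sqrt_mult_self)
  moreover have "\<dots> > 0" using pos S ellK_pos[OF assms(3)] by (simp only: S(2)) simp
  ultimately show ?thesis using assms by (metis mult_pos_pos divide_pos_pos zero_less_numeral zero_less_power)
qed

lemma wave_freq_strict_mono: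
  assumes "L > 0" "0 \<le> a" "a < b" "b < 1"
  shows "wave_freq L a < wave_freq L b"
proof (rule DERIV_pos_imp_increasing_open[OF assms(3)])
  fix x assume "a < x" "x < b"
  then show "\<exists>y. (wave_freq L has_real_derivative y) (at x) \<and> y > 0"
    using wave_freq_deriv_pos[of L x] assms by auto
next
  show "continuous_on {a..b} (wave_freq L)"
    by (rule continuous_on_subset[OF smooth_on_imp_continuous_on[OF smooth_on_wave_freq]]) (use assms in auto)
qed

lemma wave_freq_0: "wave_freq L 0 = 4 * pi\<^sup>2 / L\<^sup>2"
  by (simp add: wave_freq_def ellK_0 power_divide)

lemma wave_freq_inj_on: "L > 0 \<Longrightarrow> inj_on (wave_freq L) {0<..<1}"
proof (rule linorder_inj_onI')
  fix i j :: real assume "L > 0" "i \<in> {0<..<1}" "j \<in> {0<..<1}" "i < j"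
  then show "wave_freq L i \<noteq> wave_freq L j" using wave_freq_strict_mono[of L i j] by simp
qed

lemma wave_freq_unbounded:
  assumes "L > 0" shows "\<exists>m\<in>{0<..<1}. w \<le> wave_freq L m"
proof -
  \<comment> \<open>Chosen so that K \<ge> B and the crude bound 1/2 for the root factor already
    give a frequency of at least |w|. The added 1 keeps e below 1.\<close>
  define B where "B = sqrt (\<bar>w\<bar> * L\<^sup>2 / 8) + 1"
  define e where "e = exp (- B)"
  have B: "B \<ge> 1" by (simp add: B_def)
  then have e: "0 < e" "e < 1" by (simp_all add: e_def)
  define m where "m = 1 - e\<^sup>2"
  have m: "m \<in> {0<..<1}" using e by (simp add: m_def power_less_one_iff abs_square_less_1)
  have "B \<le> ellK m" using ellK_ge_ln[OF e] by (simp add: m_def e_def)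
  then have "sqrt (\<bar>w\<bar> * L\<^sup>2 / 8) \<le> ellK m" by (simp add: B_def)
  then have K: "\<bar>w\<bar> * L\<^sup>2 / 8 \<le> (ellK m)\<^sup>2" by (rule sqrt_le_D)
  have "(1 / 2)\<^sup>2 \<le> 1 - m + m\<^sup>2"
    using zero_le_power2[of "m - 1 / 2"] by (simp add: power2_eq_square algebra_simps)
  then have S: "1 / 2 \<le> sqrt (1 - m + m\<^sup>2)" by (rule real_le_rsqrt)
  have "\<bar>w\<bar> = 16 / L\<^sup>2 * (\<bar>w\<bar> * L\<^sup>2 / 8 * (1 / 2))" using assms by simp
  also have "\<dots> \<le> wave_freq L m"
    unfolding wave_freq_def using K S by (intro mult_left_mono mult_mono) auto
  finally show ?thesis using m by (intro bexI[of _ m]) auto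
qed

text \<open>Intermediate value theorem from m = 0, where the frequency is the threshold 4 pi^2 /
  L^2; the strict excess of \<omega> over it rules out m = 0 as the solution.\<close>

lemma wave_param:
  assumes "L > 0" "\<omega> > 4 * pi\<^sup>2 / L\<^sup>2"
  shows "wave_param L \<omega> \<in> {0<..<1}" "wave_freq L (wave_param L \<omega>) = \<omega>"
proof -
  obtain b where b: "b \<in> {0<..<1}" "\<omega> \<le> wave_freq L b" using wave_freq_unbounded[OF assms(1)] by blast
  have "\<exists>x\<ge>0. x \<le> b \<and> wave_freq L x = \<omega>"
  proof (rule IVT')
    show "continuous_on {0..b} (wave_freq L)"
      by (rule continuous_on_subset[OF smooth_on_imp_continuous_on[OF smooth_on_wave_freq]]) (use b in auto)
  qed (use assms b in \<open>simp_all add: wave_freq_0\<close>)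
  then obtain x where x: "0 \<le> x" "x \<le> b" "wave_freq L x = \<omega>" by blast
  then have "x \<noteq> 0" using assms(2) wave_freq_0 by auto
  then have "\<omega> \<in> wave_freq L ` {0<..<1}" using x b by auto
  then show "wave_param L \<omega> \<in> {0<..<1}" "wave_freq L (wave_param L \<omega>) = \<omega>"
    unfolding wave_param_def by (rule inv_into_into, rule f_inv_into_f)
qed

lemma smooth_on_wave_param:
  assumes "L > 0"
  shows "smooth_on {4 * pi\<^sup>2 / L\<^sup>2<..} (wave_param L)"
proof (rule smooth_on_implicit[where H="\<lambda>q. wave_freq L (snd q) - fst q" and V="UNIV \<times> {0<..<1}"])
  show o: "open (UNIV \<times> {0<..<1} :: (real \<times> real) set)" by (simp add: open_Times)
  show sm: "smooth_on (UNIV \<times> {0<..<1}) (\<lambda>q. wave_freq L (snd q) - fst q)"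
    by (intro smooth_on_intros o smooth_on_compose[OF smooth_on_wave_freq]) auto
  fix q :: "real \<times> real" assume q: "q \<in> UNIV \<times> {0<..<1}"
  then obtain w m where qq: "q = (w, m)" "0 < m" "m < 1" by auto
  obtain d where d: "d > 0" "(wave_freq L has_real_derivative d) (at m)" using wave_freq_deriv_pos[OF assms qq(2,3)] by blast
  have "((\<lambda>m. wave_freq L m - w) has_real_derivative frechet_derivative (\<lambda>q. wave_freq L (snd q) - fst q) (at q) (0, 1)) (at m)"
    using has_real_derivative_partial(2)[OF smooth_on_has_derivative[OF sm q, unfolded qq(1)]] by (simp add: qq(1))
  moreover have "((\<lambda>m. wave_freq L m - w) has_real_derivative d) (at m)"
    using DERIV_diff[OF d(2) DERIV_const[of w]] by simp
  ultimately have "frechet_derivative (\<lambda>q. wave_freq L (snd q) - fst q) (at q) (0, 1) = d"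
    by (rule DERIV_unique)
  then show "frechet_derivative (\<lambda>q. wave_freq L (snd q) - fst q) (at q) (0, 1) \<noteq> 0"
    using d(1) by simp
next
  fix p y z :: real
  assume "(p, y) \<in> UNIV \<times> {0<..<1}" "(p, z) \<in> UNIV \<times> {0<..<1}"
    "wave_freq L (snd (p, y)) - fst (p, y) = wave_freq L (snd (p, z)) - fst (p, z)"
  then show "y = z" by (rule_tac inj_onD[OF wave_freq_inj_on[OF assms]]) simp_all
next
  fix p :: real assume "p \<in> {4 * pi\<^sup>2 / L\<^sup>2<..}"
  then have "p > 4 * pi\<^sup>2 / L\<^sup>2" by simp
  from wave_param[OF assms this]
  show "(p, wave_param L p) \<in> UNIV \<times> {0<..<1}" "wave_freq L (snd (p, wave_param L p)) - fst (p, wave_param L p) = 0"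
    by simp_all
qed simp

text \<open>The chain rule for \<open>wave_freq\<close> after \<open>wave_param\<close> gives e d =
  1 with e > 0.\<close>

lemma wave_param_deriv_pos:
  assumes "L > 0" "\<omega> > 4 * pi\<^sup>2 / L\<^sup>2"
  shows "\<exists>d>0. (wave_param L has_real_derivative d) (at \<omega>)"
proof -
  obtain e where e: "e > 0" "(wave_freq L has_real_derivative e) (at (wave_param L \<omega>))"
    using wave_freq_deriv_pos[OF assms(1)] wave_param[OF assms] by auto
  have "wave_param L differentiable at \<omega>"
    using smooth_on_has_derivative[OF smooth_on_wave_param[OF assms(1)]] assms(2) by (auto simp: differentiable_def)
  then obtain d where d: "(wave_param L has_real_derivative d) (at \<omega>)"
    using real_differentiable_def by blast
  from DERIV_chain2[OF e(2) d]
  have "((\<lambda>w. w) has_real_derivative e * d) (at \<omega>)"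
    by (rule has_field_derivative_transform_within_open[of _ _ _ "{4 * pi\<^sup>2 / L\<^sup>2<..}"])
      (use wave_param[OF assms(1)] assms(2) in auto)
  from DERIV_unique[OF this DERIV_ident] have "e * d = 1" .
  then have "d > 0" using e(1) by (metis zero_less_mult_pos zero_less_one)
  then show ?thesis using d by blast
qed

text \<open>Three numbers with mean \<omega>, total gap D and upper gap D m are \<omega> + D (1 + m)
  / 3, \<omega> + D (1 - 2 m) / 3 and \<omega> + D (m - 2) / 3. The lemma checks that the largest is
  admissible and that \<open>beta2_of\<close> recovers the middle one from it.\<close>

lemma root_gap:
  assumes "\<omega> > 0" "0 < m" "m < 1"
  shows root_gap_pos: "root_gap \<omega> m > 0"
    and root_gap_squared: "(root_gap \<omega> m)\<^sup>2 * (1 - m + m\<^sup>2) = 9 * \<omega>\<^sup>2"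
    and root_gap_bounds: "\<omega> + root_gap \<omega> m * (1 + m) / 3 \<in> {2 * \<omega><..<3 * \<omega>}"
    and beta2_of_root_gap: "beta2_of \<omega> (\<omega> + root_gap \<omega> m * (1 + m) / 3) = \<omega> + root_gap \<omega> m * (1 - 2 * m) / 3"
proof -
  define S where "S = sqrt (1 - m + m\<^sup>2)"
  define D where "D = root_gap \<omega> m"
  have S: "S > 0" "S\<^sup>2 = 1 - m + m\<^sup>2" using quadratic_pos[of m] by (auto simp: S_def)
  have w: "\<omega> = D * S / 3" using S by (simp add: D_def root_gap_def flip: S_def)
  have D: "D > 0" using assms(1) S(1) by (simp add: D_def root_gap_def S_def)
  then show "root_gap \<omega> m > 0" by (simp add: D_def)
  show "(root_gap \<omega> m)\<^sup>2 * (1 - m + m\<^sup>2) = 9 * \<omega>\<^sup>2"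
    unfolding D_def[symmetric] S(2)[symmetric] by (simp add: w power_mult_distrib power_divide)
  \<comment> \<open>Since 3 \<omega> = D S, the bounds 2 \<omega> and 3 \<omega> amount to S < 1 + m
    < 2 S.\<close>
  have "S\<^sup>2 < (1 + m)\<^sup>2" unfolding S(2) using assms by (simp add: power2_eq_square algebra_simps)
  then have 1: "S < 1 + m" using assms by (rule_tac power2_less_imp_less) auto
  have "(1 + m)\<^sup>2 < (2 * S)\<^sup>2"
  proof -
    have "(2 * S)\<^sup>2 - (1 + m)\<^sup>2 = 3 * (1 - m)\<^sup>2" unfolding power_mult_distrib S(2) by (simp add: power2_eq_square algebra_simps)
    moreover have "3 * (1 - m)\<^sup>2 > 0" using assms by simp
    ultimately show ?thesis by linarith
  qed
  then have 2: "1 + m < 2 * S" using S by (rule_tac power2_less_imp_less) auto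
  have "D * S < D * (1 + m)" "D * (1 + m) < D * (2 * S)" using 1 2 D by (simp_all only: mult_less_cancel_left_pos)
  then show "\<omega> + root_gap \<omega> m * (1 + m) / 3 \<in> {2 * \<omega><..<3 * \<omega>}"
    unfolding D_def[symmetric] unfolding w by simp
  let ?b = "\<omega> + D * (1 + m) / 3"
  \<comment> \<open>The radicand in \<open>beta2_of\<close> is the discriminant of the quadratic for
    the two smaller roots, hence the square of their gap (1 - m) D.\<close>
  have "9 * \<omega>\<^sup>2 + 6 * \<omega> * ?b - 3 * ?b\<^sup>2 = D\<^sup>2 * (4 * S\<^sup>2 - (1 + m)\<^sup>2) / 3"
    unfolding w by (simp add: field_simps power2_eq_square)
  also have "\<dots> = ((1 - m) * D)\<^sup>2"
    unfolding S(2) by (simp add: field_simps power2_eq_square)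
  finally have "sqrt (9 * \<omega>\<^sup>2 + 6 * \<omega> * ?b - 3 * ?b\<^sup>2) = (1 - m) * D"
    using assms D by simp
  then show "beta2_of \<omega> (\<omega> + root_gap \<omega> m * (1 + m) / 3) = \<omega> + root_gap \<omega> m * (1 - 2 * m) / 3"
    unfolding beta2_of_def D_def[symmetric] by (simp add: field_simps)
qed

lemma beta1_of_root_gap:
  assumes "\<omega> > 0" "0 < m" "m < 1"
  shows "beta1_of \<omega> (\<omega> + root_gap \<omega> m * (1 + m) / 3) = \<omega> + root_gap \<omega> m * (m - 2) / 3"
  unfolding beta1_of_def beta2_of_root_gap[OF assms] by (simp add: field_simps)

lemma modulus_of_root_gap:
  assumes "\<omega> > 0" "0 < m" "m < 1"
  shows "modulus_of \<omega> (\<omega> + root_gap \<omega> m * (1 + m) / 3) = sqrt m"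
proof -
  let ?D = "root_gap \<omega> m"
  have "\<omega> + ?D * (1 + m) / 3 - (\<omega> + ?D * (1 - 2 * m) / 3) = ?D * m"
    "\<omega> + ?D * (1 + m) / 3 - (\<omega> + ?D * (m - 2) / 3) = ?D"
    by (simp_all add: field_simps)
  then show ?thesis
    using root_gap_pos[OF assms] unfolding modulus_of_def beta2_of_root_gap[OF assms] beta1_of_root_gap[OF assms] by simp
qed

text \<open>Both sides of the period equation are positive, so it may be squared; D = 3 \<omega> / S
  then turns 48 K^2 / D = L^2 into the frequency equation.\<close>

lemma period_iff_wave_freq:
  assumes "L > 0" "\<omega> > 0" "0 < m" "m < 1"
  defines "b3 \<equiv> \<omega> + root_gap \<omega> m * (1 + m) / 3"
  shows "4 * sqrt 3 / sqrt (b3 - beta1_of \<omega> b3) * elliptic_K (modulus_of \<omega> b3) = L \<longleftrightarrow> wave_freq L m = \<omega>"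
proof -
  let ?D = "root_gap \<omega> m"
  define S where "S = sqrt (1 - m + m\<^sup>2)"
  have S: "S > 0" using quadratic_pos[of m] by (simp add: S_def)
  have K: "elliptic_K (modulus_of \<omega> b3) = ellK m"
    unfolding b3_def modulus_of_root_gap[OF assms(2-4)] using assms by (simp add: elliptic_K_eq_ellK)
  have D: "b3 - beta1_of \<omega> b3 = ?D"
    unfolding b3_def beta1_of_root_gap[OF assms(2-4)] by (simp add: field_simps)
  have Dpos: "?D > 0" by (rule root_gap_pos[OF assms(2-4)])
  have "4 * sqrt 3 / sqrt ?D * ellK m = L \<longleftrightarrow> (4 * sqrt 3 / sqrt ?D * ellK m)\<^sup>2 = L\<^sup>2"
    using Dpos ellK_pos[OF assms(4)] assms(1) by (intro power2_eq_iff_nonneg[symmetric]) auto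
  also have "(4 * sqrt 3 / sqrt ?D * ellK m)\<^sup>2 = 16 * (ellK m)\<^sup>2 * S / \<omega>"
    using Dpos S assms(2) by (simp add: power_mult_distrib power_divide) (simp add: root_gap_def flip: S_def)
  also have "16 * (ellK m)\<^sup>2 * S / \<omega> = L\<^sup>2 \<longleftrightarrow> wave_freq L m = \<omega>"
    unfolding wave_freq_def S_def[symmetric] using assms(1,2) by (auto simp: field_simps)
  finally show ?thesis unfolding K D .
qed

text \<open>At m = 0 and m = 1 the parametrization reaches the ends 2 \<omega> and 3 \<omega>, so by
  continuity it covers the interval. Uniqueness in \<open>beta3\<close> rests on this.\<close>

lemma exists_root_gap_param:
  assumes "\<omega> > 0" "b \<in> {2 * \<omega><..<3 * \<omega>}"
  shows "\<exists>m\<in>{0<..<1}. b = \<omega> + root_gap \<omega> m * (1 + m) / 3"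
proof -
  let ?f = "\<lambda>m. \<omega> + root_gap \<omega> m * (1 + m) / 3"
  have nz: "sqrt (1 - m + m\<^sup>2) \<noteq> 0" for m :: real using quadratic_pos[of m] by simp
  have "\<exists>m\<ge>0. m \<le> 1 \<and> ?f m = b"
    by (rule IVT') (use assms nz in \<open>auto simp: root_gap_def intro!: continuous_intros\<close>)
  then obtain m where m: "0 \<le> m" "m \<le> 1" "?f m = b" by blast
  moreover have "m \<noteq> 0" "m \<noteq> 1" using m(3) assms(2) by (auto simp: root_gap_def)
  ultimately show ?thesis by (intro bexI[of _ m]) auto
qed

lemma freq_pos:
  assumes "L > 0" "\<omega> > 4 * pi\<^sup>2 / L\<^sup>2" shows "\<omega> > 0"
  using assms by (smt (verit) divide_nonneg_nonneg zero_le_power2)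

text \<open>A competitor b comes from some m' by \<open>exists_root_gap_param\<close>; the period
  condition forces \<open>wave_freq L m'\<close> = \<omega>, and injectivity identifies m' with
  \<open>wave_param L \<omega>\<close>.\<close>

lemma beta3_eq:
  assumes "L > 0" "\<omega> > 4 * pi\<^sup>2 / L\<^sup>2"
  shows "beta3 L \<omega> = \<omega> + root_gap \<omega> (wave_param L \<omega>) * (1 + wave_param L \<omega>) / 3"
  unfolding beta3_def
proof (rule the_equality)
  note m = wave_param[OF assms] and w = freq_pos[OF assms]
  then show "\<omega> + root_gap \<omega> (wave_param L \<omega>) * (1 + wave_param L \<omega>) / 3 \<in> {2 * \<omega><..<3 * \<omega>} \<and>
    4 * sqrt 3 / sqrt (\<omega> + root_gap \<omega> (wave_param L \<omega>) * (1 + wave_param L \<omega>) / 3 - beta1_of \<omega> (\<omega> + root_gap \<omega> (wave_param L \<omega>) * (1 + wave_param L \<omega>) / 3)) *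
    elliptic_K (modulus_of \<omega> (\<omega> + root_gap \<omega> (wave_param L \<omega>) * (1 + wave_param L \<omega>) / 3)) = L"
    using root_gap_bounds[OF w] period_iff_wave_freq[OF assms(1) w] by auto
  fix b assume b: "b \<in> {2 * \<omega><..<3 * \<omega>} \<and> 4 * sqrt 3 / sqrt (b - beta1_of \<omega> b) * elliptic_K (modulus_of \<omega> b) = L"
  then obtain m' where m': "m' \<in> {0<..<1}" "b = \<omega> + root_gap \<omega> m' * (1 + m') / 3"
    using exists_root_gap_param[OF w] by blast
  then have "wave_freq L m' = \<omega>" using b period_iff_wave_freq[OF assms(1) w, of m'] by auto
  then have "m' = wave_param L \<omega>"
    using inj_onD[OF wave_freq_inj_on[OF assms(1)], of m' "wave_param L \<omega>"] m m' by auto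
  then show "b = \<omega> + root_gap \<omega> (wave_param L \<omega>) * (1 + wave_param L \<omega>) / 3" using m' by simp
qed

text \<open>\<open>root_gap_period\<close> is the period condition in the shape used later: a shift
  of x by L moves the argument of the amplitude by 2 K, hence the amplitude by pi.\<close>

lemma
  assumes "L > 0" "\<omega> > 4 * pi\<^sup>2 / L\<^sup>2"
  shows beta2_eq: "beta2 L \<omega> = beta3 L \<omega> - root_gap \<omega> (wave_param L \<omega>) * wave_param L \<omega>"
    and beta1_eq: "beta1 L \<omega> = beta3 L \<omega> - root_gap \<omega> (wave_param L \<omega>)"
    and modulus_eq: "modulus L \<omega> = sqrt (wave_param L \<omega>)"
    and root_gap_period: "sqrt (root_gap \<omega> (wave_param L \<omega>) / 12) * L = 2 * ellK (wave_param L \<omega>)"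
proof -
  let ?m = "wave_param L \<omega>"
  let ?D = "root_gap \<omega> ?m"
  note w = freq_pos[OF assms]
  have m: "0 < ?m" "?m < 1" "wave_freq L ?m = \<omega>" using wave_param[OF assms] by auto
  show "beta2 L \<omega> = beta3 L \<omega> - ?D * ?m"
    unfolding beta2_def beta3_eq[OF assms] beta2_of_root_gap[OF w m(1,2)] by (simp add: field_simps)
  show 1: "beta1 L \<omega> = beta3 L \<omega> - ?D"
    unfolding beta1_def beta3_eq[OF assms] beta1_of_root_gap[OF w m(1,2)] by (simp add: field_simps)
  show "modulus L \<omega> = sqrt ?m"
    unfolding modulus_def beta3_eq[OF assms] modulus_of_root_gap[OF w m(1,2)] ..
  have D: "?D > 0" by (rule root_gap_pos[OF w m(1,2)])
  have "4 * sqrt 3 / sqrt ?D * ellK ?m = L"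
    using m(3) period_iff_wave_freq[OF assms(1) w m(1,2)] 1 m
    unfolding beta1_def beta3_eq[OF assms] modulus_of_root_gap[OF w m(1,2)] by (simp add: elliptic_K_eq_ellK)
  moreover have "sqrt (?D / 12) * (4 * sqrt 3 / sqrt ?D * ellK ?m) = 2 * ellK ?m"
    using D real_sqrt_mult[of 4 3] by (simp add: real_sqrt_divide)
  ultimately show "sqrt (?D / 12) * L = 2 * ellK ?m" by simp
qed

subsection \<open>The cnoidal wave\<close>

text \<open>Replacing cn^2 by 1 - sn^2 leaves a formula in c and the smooth functions
  \<open>wave_param\<close> and \<open>ell_am\<close>; the equation, the period and joint smoothness
  are all read off from it.\<close>

lemma phi_eq:
  assumes "L > 0" "c > 2 * pi\<^sup>2 / L\<^sup>2"
  defines "m \<equiv> wave_param L (2 * c)" and "D \<equiv> root_gap (2 * c) (wave_param L (2 * c))"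
  shows "phi L c x = (2 * c + D * (1 + m) / 3 - D * m * (sin (ell_am (m, sqrt (D / 12) * x)))\<^sup>2) / 4"
proof -
  have w: "2 * c > 4 * pi\<^sup>2 / L\<^sup>2" using assms(2) by simp
  have m: "0 < m" using wave_param(1)[OF assms(1) w] by (simp add: m_def)
  have mod: "(modulus L (2 * c))\<^sup>2 = m" unfolding modulus_eq[OF assms(1) w] using m by (simp add: m_def)
  have gap: "beta3 L (2 * c) - beta1 L (2 * c) = D" "beta3 L (2 * c) - beta2 L (2 * c) = D * m"
    unfolding beta1_eq[OF assms(1) w] beta2_eq[OF assms(1) w] by (simp_all add: m_def D_def)
  have "phi L c x = (beta3 L (2 * c) - D * m + D * m * (cos (ell_am (m, sqrt (D / 12) * x)))\<^sup>2) / 4"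
    unfolding phi_def cnoidal_def jacobi_cn_def jacobi_am_eq mod gap using gap(2) by (simp add: algebra_simps)
  then show ?thesis
    unfolding beta3_eq[OF assms(1) w] m_def D_def by (simp add: cos_squared_eq algebra_simps)
qed

lemma smooth_on_phi:
  assumes "L > 0"
  shows "smooth_on ({2 * pi\<^sup>2 / L\<^sup>2<..} \<times> UNIV) (\<lambda>(c, x). phi L c x)"
proof -
  define U where "U = {2 * pi\<^sup>2 / L\<^sup>2<..} \<times> (UNIV :: real set)"
  have U: "open U" by (simp add: U_def open_Times)
  define m where "m = (\<lambda>q :: real \<times> real. wave_param L (2 * fst q))"
  define D where "D = (\<lambda>q :: real \<times> real. root_gap (2 * fst q) (m q))"
  have m01: "m q \<in> {0<..<1}" if "q \<in> U" for q
    using wave_param(1)[OF assms, of "2 * fst q"] that by (auto simp: m_def U_def)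
  have Dpos: "D q > 0" if "q \<in> U" for q
  proof -
    have "2 * fst q > 4 * pi\<^sup>2 / L\<^sup>2" using that by (auto simp: U_def)
    from freq_pos[OF assms this] show ?thesis
      unfolding D_def using m01[OF that] by (intro root_gap_pos) auto
  qed
  have nz: "sqrt (1 - m q + (m q)\<^sup>2) \<noteq> 0" for q using quadratic_pos[of "m q"] by simp
  have sm: "smooth_on U m" unfolding m_def
    by (rule smooth_on_compose[OF smooth_on_wave_param[OF assms]])
      (auto intro!: smooth_on_intros simp: U_def open_Times)
  have sD: "smooth_on U D" unfolding D_def root_gap_def
    by (intro smooth_on_intros U sm quadratic_pos nz)
  have "smooth_on U (\<lambda>q. (2 * fst q + D q * (1 + m q) / 3 - D q * m q * (sin (ell_am (m q, sqrt (D q / 12) * snd q)))\<^sup>2) / 4)"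
    by (intro smooth_on_intros smooth_on_compose[OF smooth_on_ell_am] U sm sD)
      (use m01 Dpos in \<open>auto simp: open_Times\<close>)
  then show ?thesis unfolding U_def[symmetric]
    by (rule smooth_on_cong[OF U, rotated]) (auto simp: U_def m_def D_def phi_eq[OF assms])
qed

text \<open>Here s stands for sin^2 of the amplitude. The left-hand side is a quadratic in s whose s
  and s^2 terms cancel; the remaining constant is a multiple of 9 w^2 - D^2 (1 - m + m^2).\<close>

lemma profile_ode:
  fixes w D m s :: real
  assumes "D\<^sup>2 * (1 - m + m\<^sup>2) = 9 * w\<^sup>2" "\<phi> = (w + D * (1 + m) / 3 - D * m * s) / 4"
  shows "- (- (D\<^sup>2 * m / 24 * ((1 - 2 * s) * (1 - m * s) - m * s * (1 - s)))) + w * \<phi> - 2 * \<phi>\<^sup>2 = 0"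
proof -
  have "- (- (D\<^sup>2 * m / 24 * ((1 - 2 * s) * (1 - m * s) - m * s * (1 - s)))) + w * \<phi> - 2 * \<phi>\<^sup>2
      = (9 * w\<^sup>2 - D\<^sup>2 * (1 - m + m\<^sup>2)) / 72"
    unfolding assms(2) by (simp add: field_simps power2_eq_square)
  then show ?thesis using assms(1) by simp
qed

text \<open>Jacobi's rules am' = dn and dn' = - m sn cn, scaled by a, make the second derivative a
  polynomial in sin^2 of the amplitude, and a^2 = D / 12 removes a. This is
  \<open>profile_ode\<close> with w = 2 c.\<close>

lemma phi_ode:
  assumes "L > 0" "c > 2 * pi\<^sup>2 / L\<^sup>2"
  shows "phi L c differentiable (at x)" "deriv (phi L c) differentiable (at x)"
    "- deriv (deriv (phi L c)) x + 2 * c * phi L c x - 2 * (phi L c x)\<^sup>2 = 0"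
proof -
  define m where "m = wave_param L (2 * c)"
  define D where "D = root_gap (2 * c) m"
  define a where "a = sqrt (D / 12)"
  define \<theta> where "\<theta> = (\<lambda>x. ell_am (m, a * x))"
  define \<Delta> where "\<Delta> = (\<lambda>x. sqrt (1 - m * (sin (\<theta> x))\<^sup>2))"
  have w: "2 * c > 4 * pi\<^sup>2 / L\<^sup>2" using assms(2) by simp
  have m: "0 < m" "m < 1" using wave_param(1)[OF assms(1) w] by (auto simp: m_def)
  have Dpos: "D > 0" and D2: "D\<^sup>2 * (1 - m + m\<^sup>2) = 9 * (2 * c)\<^sup>2"
    unfolding D_def using root_gap_pos root_gap_squared freq_pos[OF assms(1) w] m by blast+
  have a2: "a\<^sup>2 = D / 12" using Dpos by (simp add: a_def)
  have pos: "1 - m * (sin (\<theta> x))\<^sup>2 > 0" for x by (rule one_minus_mult_sin_squared_pos[OF m(2)])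
  have \<Delta>2: "(\<Delta> x)\<^sup>2 = 1 - m * (sin (\<theta> x))\<^sup>2" and \<Delta>nz: "\<Delta> x > 0" for x using pos[of x] by (auto simp: \<Delta>_def)
  have d\<theta>: "(\<theta> has_real_derivative a * \<Delta> x) (at x)" for x
  proof -
    have "(\<theta> has_real_derivative \<Delta> x * a) (at x)"
      unfolding \<Delta>_def \<theta>_def
      by (rule DERIV_chain2[of "\<lambda>u. ell_am (m, u)", OF has_real_derivative_ell_am[OF m(2)] DERIV_cmult_Id[of a]])
    then show ?thesis by (simp only: mult.commute[of a])
  qed
  have d\<Delta>: "(\<Delta> has_real_derivative - m * a * sin (\<theta> x) * cos (\<theta> x)) (at x)" for x
  proof -
    have "((\<lambda>x. 1 - m * (sin (\<theta> x))\<^sup>2) has_real_derivative - (m * (2 * sin (\<theta> x) * (cos (\<theta> x) * (a * \<Delta> x))))) (at x)"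
      by (auto intro!: derivative_eq_intros d\<theta>)
    from DERIV_chain2[OF DERIV_real_sqrt[OF pos] this]
    have "(\<Delta> has_real_derivative inverse (\<Delta> x) / 2 * - (m * (2 * sin (\<theta> x) * (cos (\<theta> x) * (a * \<Delta> x))))) (at x)"
      by (simp only: \<Delta>_def)
    then show ?thesis using \<Delta>nz[of x] by (simp add: field_simps)
  qed
  have eq: "phi L c = (\<lambda>x. (2 * c + D * (1 + m) / 3 - D * m * (sin (\<theta> x))\<^sup>2) / 4)"
    using phi_eq[OF assms] by (auto simp: m_def D_def a_def \<theta>_def)
  have d1: "(phi L c has_real_derivative - (D * m * a / 2) * (sin (\<theta> x) * cos (\<theta> x) * \<Delta> x)) (at x)" for x
    unfolding eq by (auto intro!: derivative_eq_intros d\<theta>)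
  then have der1: "deriv (phi L c) = (\<lambda>x. - (D * m * a / 2) * (sin (\<theta> x) * cos (\<theta> x) * \<Delta> x))"
    by (auto simp: DERIV_imp_deriv)
  let ?s = "(sin (\<theta> x))\<^sup>2"
  have d2: "(deriv (phi L c) has_real_derivative
      - (D\<^sup>2 * m / 24 * ((1 - 2 * ?s) * (1 - m * ?s) - m * ?s * (1 - ?s)))) (at x)"
  proof -
    have "((\<lambda>x. sin (\<theta> x) * cos (\<theta> x) * \<Delta> x) has_real_derivative
        ((cos (\<theta> x))\<^sup>2 - (sin (\<theta> x))\<^sup>2) * a * (\<Delta> x)\<^sup>2 - m * a * (sin (\<theta> x))\<^sup>2 * (cos (\<theta> x))\<^sup>2) (at x)"
      by (auto intro!: derivative_eq_intros d\<theta> d\<Delta> simp: algebra_simps power2_eq_square)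
    from DERIV_cmult[OF this, of "- (D * m * a / 2)"]
    have "(deriv (phi L c) has_real_derivative - (D * m * a / 2) *
        (((cos (\<theta> x))\<^sup>2 - (sin (\<theta> x))\<^sup>2) * a * (\<Delta> x)\<^sup>2 - m * a * (sin (\<theta> x))\<^sup>2 * (cos (\<theta> x))\<^sup>2)) (at x)"
      unfolding der1 .
    also have "- (D * m * a / 2) *
        (((cos (\<theta> x))\<^sup>2 - (sin (\<theta> x))\<^sup>2) * a * (\<Delta> x)\<^sup>2 - m * a * (sin (\<theta> x))\<^sup>2 * (cos (\<theta> x))\<^sup>2)
      = - (D * m * a\<^sup>2 / 2 * ((1 - 2 * ?s) * (1 - m * ?s) - m * ?s * (1 - ?s)))"
      unfolding \<Delta>2 cos_squared_eq by (simp add: algebra_simps power2_eq_square)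
    also have "\<dots> = - (D\<^sup>2 * m / 24 * ((1 - 2 * ?s) * (1 - m * ?s) - m * ?s * (1 - ?s)))"
      unfolding a2 by (simp add: power2_eq_square)
    finally show ?thesis .
  qed
  show "phi L c differentiable (at x)" "deriv (phi L c) differentiable (at x)"
    using d1 d2 real_differentiable_def by blast+
  show "- deriv (deriv (phi L c)) x + 2 * c * phi L c x - 2 * (phi L c x)\<^sup>2 = 0"
    unfolding DERIV_imp_deriv[OF d2] by (rule profile_ode[OF D2]) (simp add: eq)
qed

lemma phi_fundamental_period:
  assumes "L > 0" "c > 2 * pi\<^sup>2 / L\<^sup>2"
  shows "fundamental_period (phi L c) L"
proof -
  define m where "m = wave_param L (2 * c)"
  define D where "D = root_gap (2 * c) m"
  define a where "a = sqrt (D / 12)"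
  have w: "2 * c > 4 * pi\<^sup>2 / L\<^sup>2" using assms(2) by simp
  have m: "0 < m" "m < 1" using wave_param(1)[OF assms(1) w] by (auto simp: m_def)
  have Dpos: "D > 0" unfolding D_def using root_gap_pos freq_pos[OF assms(1) w] m by blast
  then have apos: "a > 0" by (simp add: a_def)
  have aL: "a * L = 2 * ellK m"
    using root_gap_period[OF assms(1) w] by (simp add: a_def D_def m_def)
  have eq: "phi L c x = (2 * c + D * (1 + m) / 3 - D * m * (sin (ell_am (m, a * x)))\<^sup>2) / 4" for x
    using phi_eq[OF assms] by (simp add: m_def D_def a_def)
  have "phi L c (x + L) = phi L c x" for x
    using ell_am_plus[OF m(2), of "a * x"] by (simp add: eq distrib_left aL)
  moreover have "L \<le> S" if "S > 0" and per: "\<forall>x. phi L c (x + S) = phi L c x" for S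
  proof -
    have am0: "ell_am (m, 0) = 0" using ell_am_ellF[OF m(2), of 0] by simp
    have "phi L c S = phi L c 0" using per[rule_format, of 0] by simp
    \<comment> \<open>The value at 0 is attained only where the sine of the amplitude vanishes. A
      period S thus puts the amplitude at i pi with i \<ge> 1, whence a S = 2 i K \<ge> 2 K = a
      L.\<close>
    then have "sin (ell_am (m, a * S)) = 0" using Dpos m by (simp add: eq am0)
    then obtain i :: int where i: "ell_am (m, a * S) = of_int i * pi" using sin_zero_iff_int2 by blast
    have "ell_am (m, a * S) > 0"
    proof (rule ccontr)
      assume "\<not> ell_am (m, a * S) > 0"
      then have "ellF (m, ell_am (m, a * S)) \<le> ellF (m, 0)"
        using ellF_strict_mono[OF m(2), of "ell_am (m, a * S)" 0] by (cases "ell_am (m, a * S) = 0") auto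
      then show False using mult_pos_pos[OF apos that(1)] by (simp add: ellF_ell_am[OF m(2)])
    qed
    then have "i \<ge> 1" using i by (simp add: zero_less_mult_iff)
    then have "ell_am (m, a * S) = of_nat (nat i) * pi" "nat i \<ge> 1" using i by auto
    then have "a * S = 2 * of_nat (nat i) * ellK m"
      using ellF_ell_am[OF m(2), of "a * S"] ellF_of_nat_pi[OF m(2), of "nat i"] by simp
    moreover have "1 * ellK m \<le> of_nat (nat i) * ellK m"
      using \<open>nat i \<ge> 1\<close> ellK_pos[OF m(2)] by (intro mult_right_mono) auto
    ultimately have "a * L \<le> a * S" using aL by simp
    then show "L \<le> S" using apos by simp
  qed
  ultimately show ?thesis using assms(1) by (simp add: fundamental_period_def)
qed

lemma modulus_deriv_pos:
  assumes "L > 0" "c > 2 * pi\<^sup>2 / L\<^sup>2"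
  shows "\<exists>d>0. ((\<lambda>c. modulus L (2 * c)) has_real_derivative d) (at c)"
proof -
  have w: "2 * c > 4 * pi\<^sup>2 / L\<^sup>2" using assms(2) by simp
  obtain d where d: "d > 0" "(wave_param L has_real_derivative d) (at (2 * c))"
    using wave_param_deriv_pos[OF assms(1) w] by blast
  have m: "wave_param L (2 * c) > 0" using wave_param(1)[OF assms(1) w] by simp
  have "((\<lambda>c. wave_param L (2 * c)) has_real_derivative d * 2) (at c)"
    by (rule DERIV_chain2[of "wave_param L" d "\<lambda>c. 2 * c", OF d(2)]) (auto intro!: derivative_eq_intros)
  from DERIV_chain2[OF DERIV_real_sqrt[OF m] this]
  have "((\<lambda>c. sqrt (wave_param L (2 * c))) has_real_derivative inverse (sqrt (wave_param L (2 * c))) / 2 * (d * 2)) (at c)" .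
  then have "((\<lambda>c. modulus L (2 * c)) has_real_derivative inverse (sqrt (wave_param L (2 * c))) / 2 * (d * 2)) (at c)"
    by (rule has_field_derivative_transform_within_open[of _ _ _ "{2 * pi\<^sup>2 / L\<^sup>2<..}"])
      (use assms in \<open>auto simp: modulus_eq\<close>)
  then show ?thesis using d(1) m by (intro exI[of _ "inverse (sqrt (wave_param L (2 * c))) / 2 * (d * 2)"]) simp
qed

subsection \<open>Smooth curves in periodic Sobolev spaces\<close>

lemma continuous_on_fourier_kernel: "continuous_on A (\<lambda>x. cis (- 2 * pi * of_int m * x / L))"
proof -
  have "continuous_on A (\<lambda>x. cis ((- 2 * pi * of_int m / L) * x))" by (intro continuous_intros)
  then show ?thesis by simp
qed

lemma fourier_coeff_eq_integral:
  assumes "continuous_on {0..L} f"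
  shows "fourier_coeff L f m =
    of_real (1 / L) * integral {0..L} (\<lambda>x. of_real (f x) * cis (- 2 * pi * of_int m * x / L))"
proof -
  have "set_integrable lborel {0..L} (\<lambda>x. of_real (f x) * cis (- 2 * pi * of_int m * x / L))"
    by (intro borel_integrable_atLeastAtMost' continuous_on_fourier_kernel continuous_on_mult continuous_on_of_real assms)
  from set_borel_integral_eq_integral(2)[OF this] show ?thesis by (simp add: fourier_coeff_def)
qed

lemma fourier_coeff_diff:
  assumes "continuous_on {0..L} f" "continuous_on {0..L} g"
  shows "fourier_coeff L (\<lambda>x. f x - g x) m = fourier_coeff L f m - fourier_coeff L g m"
proof -
  have "integral {0..L} (\<lambda>x. of_real (f x) * cis (- 2 * pi * of_int m * x / L) - of_real (g x) * cis (- 2 * pi * of_int m * x / L))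
    = integral {0..L} (\<lambda>x. of_real (f x) * cis (- 2 * pi * of_int m * x / L)) - integral {0..L} (\<lambda>x. of_real (g x) * cis (- 2 * pi * of_int m * x / L))"
    by (intro integral_diff integrable_continuous_interval continuous_on_fourier_kernel continuous_on_mult continuous_on_of_real assms)
  then show ?thesis
    using assms by (simp add: fourier_coeff_eq_integral continuous_on_diff left_diff_distrib right_diff_distrib)
qed

lemma fourier_coeff_scale: "fourier_coeff L (\<lambda>x. a * f x) m = of_real a * fourier_coeff L f m"
  unfolding fourier_coeff_def set_lebesgue_integral_def
  by (simp add: scaleR_conv_of_real mult.assoc mult.left_commute[of _ "of_real a"])

lemma cmod_fourier_coeff_le:
  assumes "L > 0" "continuous_on {0..L} f" "\<And>x. x \<in> {0..L} \<Longrightarrow> \<bar>f x\<bar> \<le> B"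
  shows "cmod (fourier_coeff L f m) \<le> B"
proof -
  have "cmod (integral {0..L} (\<lambda>x. of_real (f x) * cis (- 2 * pi * of_int m * x / L))) \<le> B * (L - 0)"
    using assms by (intro integral_bound continuous_on_fourier_kernel continuous_on_mult continuous_on_of_real) (auto simp: norm_mult)
  then show ?thesis
    using assms(1) by (simp add: fourier_coeff_eq_integral[OF assms(2)] norm_mult norm_divide field_simps)
qed

text \<open>Integration by parts, run as the fundamental theorem for f times the kernel: the
  boundary terms cancel because both factors agree at 0 and L.\<close>

lemma fourier_coeff_deriv:
  assumes "L > 0" "\<And>x. (f has_real_derivative f' x) (at x)" "continuous_on {0..L} f'" "f L = f 0"
  shows "fourier_coeff L f' m = (2 * pi * of_int m / L) *\<^sub>R (\<i> * fourier_coeff L f m)"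
proof -
  let ?e = "\<lambda>x. cis (- 2 * pi * of_int m * x / L)"
  let ?r = "2 * pi * of_int m / L"
  have contf: "continuous_on {0..L} f"
    by (intro continuous_at_imp_continuous_on ballI) (rule DERIV_isCont[OF assms(2)])
  have "((\<lambda>x. of_real (f' x) * ?e x - ?r *\<^sub>R (\<i> * (of_real (f x) * ?e x))) has_integral
      of_real (f L) * ?e L - of_real (f 0) * ?e 0) {0..L}"
  proof (rule fundamental_theorem_of_calculus)
    fix x
    have "((\<lambda>x. complex_of_real (f x)) has_vector_derivative of_real (f' x)) (at x within {0..L})"
      using assms(2)[of x] by (intro has_vector_derivative_of_real) (auto intro: has_field_derivative_at_within simp: has_real_derivative_iff_has_vector_derivative[symmetric])
    moreover have "(?e has_vector_derivative (- ?r) *\<^sub>R (\<i> * ?e x)) (at x within {0..L})"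
      unfolding has_vector_derivative_def
      by (rule derivative_eq_intros refl)+ (use assms(1) in \<open>auto simp: field_simps\<close>)
    ultimately have "((\<lambda>x. of_real (f x) * ?e x) has_vector_derivative of_real (f x) * ((- ?r) *\<^sub>R (\<i> * ?e x)) + of_real (f' x) * ?e x) (at x within {0..L})"
      by (rule has_vector_derivative_mult)
    then show "((\<lambda>x. of_real (f x) * ?e x) has_vector_derivative of_real (f' x) * ?e x - ?r *\<^sub>R (\<i> * (of_real (f x) * ?e x))) (at x within {0..L})"
      by (simp add: scaleR_conv_of_real algebra_simps)
  qed (use assms in simp)
  moreover have "?e L = ?e 0"
  proof -
    have "?e L = cis (2 * pi * of_int (- m))" using assms(1) by simp
    then show ?thesis by (simp add: cis_multiple_2pi del: of_int_minus)
  qed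
  ultimately have "((\<lambda>x. of_real (f' x) * ?e x - ?r *\<^sub>R (\<i> * (of_real (f x) * ?e x))) has_integral 0) {0..L}"
    using assms(4) by simp
  then have "0 = integral {0..L} (\<lambda>x. of_real (f' x) * ?e x - ?r *\<^sub>R (\<i> * (of_real (f x) * ?e x)))"
    by (rule integral_unique[symmetric])
  also have "\<dots> = integral {0..L} (\<lambda>x. of_real (f' x) * ?e x) - integral {0..L} (\<lambda>x. ?r *\<^sub>R (\<i> * (of_real (f x) * ?e x)))"
    by (intro integral_diff integrable_continuous_interval continuous_on_fourier_kernel continuous_on_mult continuous_on_of_real continuous_on_scaleR continuous_on_const contf assms)
  also have "integral {0..L} (\<lambda>x. ?r *\<^sub>R (\<i> * (of_real (f x) * ?e x))) = ?r *\<^sub>R (\<i> * integral {0..L} (\<lambda>x. of_real (f x) * ?e x))"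
    by (simp only: integral_cmul integral_mult_right)
  finally have "integral {0..L} (\<lambda>x. of_real (f' x) * ?e x) = ?r *\<^sub>R (\<i> * integral {0..L} (\<lambda>x. of_real (f x) * ?e x))"
    by simp
  then show ?thesis
    unfolding fourier_coeff_eq_integral[OF contf] fourier_coeff_eq_integral[OF assms(3)]
    by (simp add: scaleR_conv_of_real)
qed

text \<open>Each derivative multiplies the modulus of the coefficient by 2 pi |m| / L, so orders 0
  and n + 1 suffice. For m nonzero, 1 + m^2 \<le> 2 m^2, which is L^2 / (2 pi^2) times (2 pi m /
  L)^2; the summand 1 in the constant serves m = 0.\<close>

lemma fourier_coeff_decay:
  fixes d :: "nat \<Rightarrow> real \<Rightarrow> real" and m :: int
  assumes "L > 0" and der: "\<And>i x. (d i has_real_derivative d (Suc i) x) (at x)"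
    and per: "\<And>i x. d i (x + L) = d i x"
    and B: "\<And>x. x \<in> {0..L} \<Longrightarrow> \<bar>d 0 x\<bar> \<le> B" "\<And>x. x \<in> {0..L} \<Longrightarrow> \<bar>d (Suc n) x\<bar> \<le> B"
  shows "(1 + (of_int m)\<^sup>2) ^ Suc n * (cmod (fourier_coeff L (d 0) m))\<^sup>2 \<le> (1 + (L\<^sup>2 / (2 * pi\<^sup>2)) ^ Suc n) * B\<^sup>2"
proof -
  have cont: "continuous_on A (d i)" for A i
    by (intro continuous_at_imp_continuous_on ballI) (rule DERIV_isCont[OF der])
  let ?c = "\<lambda>i. cmod (fourier_coeff L (d i) m)"
  have c: "?c i = (2 * pi * \<bar>of_int m\<bar> / L) ^ i * ?c 0" for i
  proof (induction i)
    case (Suc i)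
    have "d i L = d i 0" using per[of i 0] by simp
    from fourier_coeff_deriv[OF assms(1) der cont this, of m]
    show ?case using Suc assms(1) by (simp add: norm_mult abs_mult)
  qed simp
  have b: "?c 0 \<le> B" "?c (Suc n) \<le> B"
    by (intro cmod_fourier_coeff_le assms cont; assumption)+
  then have b2: "(?c 0)\<^sup>2 \<le> B\<^sup>2" "(?c (Suc n))\<^sup>2 \<le> B\<^sup>2" by (simp_all add: power_mono)
  have q: "0 \<le> (L\<^sup>2 / (2 * pi\<^sup>2)) ^ Suc n" by simp
  show ?thesis
  proof (cases "m = 0")
    case True
    have "(?c 0)\<^sup>2 \<le> 1 * B\<^sup>2" using b2 by simp
    also have "\<dots> \<le> (1 + (L\<^sup>2 / (2 * pi\<^sup>2)) ^ Suc n) * B\<^sup>2" using q by (intro mult_right_mono) auto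
    finally show ?thesis using True by simp
  next
    case False
    let ?m = "of_int m :: real"
    have "1 \<le> \<bar>?m\<bar>" using False by linarith
    then have "1 \<le> ?m\<^sup>2" by (metis one_le_power power2_abs)
    then have "(1 + ?m\<^sup>2) ^ Suc n \<le> (2 * ?m\<^sup>2) ^ Suc n" by (intro power_mono) auto
    also have "2 * ?m\<^sup>2 = (L\<^sup>2 / (2 * pi\<^sup>2)) * (2 * pi * \<bar>?m\<bar> / L)\<^sup>2"
      using assms(1) by (simp add: power_mult_distrib power_divide field_simps)
    finally have "(1 + ?m\<^sup>2) ^ Suc n * (?c 0)\<^sup>2 \<le> ((L\<^sup>2 / (2 * pi\<^sup>2)) * (2 * pi * \<bar>?m\<bar> / L)\<^sup>2) ^ Suc n * (?c 0)\<^sup>2"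
      by (intro mult_right_mono) auto
    also have "\<dots> = (L\<^sup>2 / (2 * pi\<^sup>2)) ^ Suc n * (?c (Suc n))\<^sup>2"
      unfolding c[of "Suc n"] power_mult_distrib power_mult[symmetric] by (simp only: mult.commute[of 2] mult.assoc)
    also have "\<dots> \<le> (L\<^sup>2 / (2 * pi\<^sup>2)) ^ Suc n * B\<^sup>2" using b2 q by (intro mult_left_mono)
    also have "\<dots> \<le> (1 + (L\<^sup>2 / (2 * pi\<^sup>2)) ^ Suc n) * B\<^sup>2" by (intro mult_right_mono) auto
    finally show ?thesis .
  qed
qed

lemma summable_on_int_inverse_square: "(\<lambda>m::int. 1 / (1 + (of_int m)\<^sup>2 :: real)) summable_on UNIV"
proof -
  have "summable (\<lambda>n. norm (1 / (1 + (real n)\<^sup>2)))"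
  proof (rule summable_comparison_test'[OF inverse_power_summable[of 2], where N=1])
    fix n :: nat assume "n \<ge> 1"
    then show "norm (norm (1 / (1 + (real n)\<^sup>2))) \<le> inverse ((real n)\<^sup>2)"
      by (simp add: divide_inverse le_imp_inverse_le)
  qed simp
  then have nat: "(\<lambda>n. 1 / (1 + (real n)\<^sup>2)) summable_on UNIV" by (rule norm_summable_imp_summable_on)
  have U: "(UNIV :: int set) = range int \<union> range (\<lambda>n. - int n)"
  proof -
    have "z \<in> range int \<union> range (\<lambda>n. - int n)" for z by (cases z rule: int_cases2) auto
    then show ?thesis by blast
  qed
  have i: "inj (\<lambda>n. - int n)" by (simp add: inj_on_def)
  show ?thesis unfolding U
    by (rule summable_on_union; subst summable_on_reindex) (use nat in \<open>simp_all add: o_def i\<close>)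
qed

text \<open>The assumed bound carries one power of the weight more than the order n; dividing by it
  leaves the summable factor 1 / (1 + m^2).\<close>

lemma Hper_weights:
  assumes "\<And>m::int. (1 + (of_int m)\<^sup>2) ^ Suc n * (cmod (fourier_coeff L g m))\<^sup>2 \<le> C"
  shows Hper_weights_summable:
      "(\<lambda>m::int. (1 + (of_int m)\<^sup>2) ^ n * (cmod (fourier_coeff L g m))\<^sup>2) summable_on UNIV" (is ?A)
    and Hper_norm_le: "L > 0 \<Longrightarrow> Hper_norm L n g \<le> sqrt (L * (C * (\<Sum>\<^sub>\<infinity>m::int. 1 / (1 + (of_int m)\<^sup>2))))"
proof -
  have le: "(1 + (of_int m)\<^sup>2) ^ n * (cmod (fourier_coeff L g m))\<^sup>2 \<le> C * (1 / (1 + (of_int m)\<^sup>2))" for m :: int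
  proof -
    have p: "0 < 1 + (of_int m :: real)\<^sup>2" by (simp add: add_pos_nonneg)
    show ?thesis using assms[of m] p by (simp add: field_simps)
  qed
  have s: "(\<lambda>m::int. C * (1 / (1 + (of_int m :: real)\<^sup>2))) summable_on UNIV"
    by (intro summable_on_cmult_right summable_on_int_inverse_square)
  show ?A by (rule summable_on_comparison_test[OF s le]) auto
  from infsum_mono[OF this s le]
  have "(\<Sum>\<^sub>\<infinity>m::int. (1 + (of_int m)\<^sup>2) ^ n * (cmod (fourier_coeff L g m))\<^sup>2) \<le> C * (\<Sum>\<^sub>\<infinity>m::int. 1 / (1 + (of_int m)\<^sup>2))"
    by (simp add: infsum_cmult_right summable_on_int_inverse_square del: times_divide_eq_right)
  then show "L > 0 \<Longrightarrow> Hper_norm L n g \<le> sqrt (L * (C * (\<Sum>\<^sub>\<infinity>m::int. 1 / (1 + (of_int m)\<^sup>2))))"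
    unfolding Hper_norm_def by (intro real_sqrt_le_mono mult_left_mono) auto
qed

lemma Hper_norm_nonneg: "L > 0 \<Longrightarrow> 0 \<le> Hper_norm L n g"
  unfolding Hper_norm_def by (intro real_sqrt_ge_zero mult_nonneg_nonneg infsum_nonneg) auto

section \<open>Jointly smooth periodic families as curves in \<open>Hper\<close>\<close>

abbreviation partial1 :: "(real \<times> real \<Rightarrow> real) \<Rightarrow> real \<times> real \<Rightarrow> real" where
  "partial1 f \<equiv> \<lambda>p. frechet_derivative f (at p) (1, 0)"

abbreviation partial2 :: "(real \<times> real \<Rightarrow> real) \<Rightarrow> real \<times> real \<Rightarrow> real" where
  "partial2 f \<equiv> \<lambda>p. frechet_derivative f (at p) (0, 1)"

text \<open>A class closed under both partial derivatives when I is open: \<open>partial1\<close>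
  produces the derivatives of the curve, \<open>partial2\<close> the x-derivatives that control the
  Fourier coefficients.\<close>

definition periodic_smooth :: "real \<Rightarrow> real set \<Rightarrow> (real \<times> real \<Rightarrow> real) \<Rightarrow> bool" where
  "periodic_smooth L I f \<longleftrightarrow> smooth_on (I \<times> UNIV) f \<and> (\<forall>c\<in>I. \<forall>x. f (c, x + L) = f (c, x))"

lemma periodic_smooth_derivs:
  assumes "periodic_smooth L I f" "c \<in> I"
  shows "((\<lambda>c. f (c, x)) has_real_derivative partial1 f (c, x)) (at c)"
    and "((\<lambda>x. f (c, x)) has_real_derivative partial2 f (c, x)) (at x)"
  using assms has_real_derivative_partial[OF smooth_on_has_derivative[of "I \<times> UNIV" f "(c, x)"]]
  by (auto simp: periodic_smooth_def)

lemma periodic_smooth_partial1: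
  assumes "open I" "periodic_smooth L I f"
  shows "periodic_smooth L I (partial1 f)"
proof -
  have "partial1 f (c, x + L) = partial1 f (c, x)" if "c \<in> I" for c x
  proof -
    have "((\<lambda>c. f (c, x)) has_real_derivative partial1 f (c, x + L)) (at c)"
      by (rule has_field_derivative_transform_within_open[OF periodic_smooth_derivs(1)[OF assms(2) that] assms(1) that])
        (use assms(2) in \<open>auto simp: periodic_smooth_def\<close>)
    from DERIV_unique[OF this periodic_smooth_derivs(1)[OF assms(2) that]] show ?thesis .
  qed
  then show ?thesis using assms by (auto simp: periodic_smooth_def intro: smooth_on_frechet_derivative)
qed

lemma periodic_smooth_partial2:
  assumes "periodic_smooth L I f"
  shows "periodic_smooth L I (partial2 f)"
proof -
  have "partial2 f (c, x + L) = partial2 f (c, x)" if "c \<in> I" for c x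
  proof -
    have "((\<lambda>x. f (c, x + L)) has_real_derivative partial2 f (c, x + L)) (at x)"
      using periodic_smooth_derivs(2)[OF assms that, of "x + L"] by (simp add: DERIV_shift)
    moreover have "(\<lambda>x. f (c, x + L)) = (\<lambda>x. f (c, x))"
      using assms that by (auto simp: periodic_smooth_def)
    ultimately show ?thesis using periodic_smooth_derivs(2)[OF assms that, of x] DERIV_unique by auto
  qed
  then show ?thesis using assms by (auto simp: periodic_smooth_def intro: smooth_on_frechet_derivative)
qed

lemma periodic_smooth_funpow:
  assumes "\<And>g. periodic_smooth L I g \<Longrightarrow> periodic_smooth L I (D g)" "periodic_smooth L I f"
  shows "periodic_smooth L I ((D ^^ i) f)"
  by (induction i) (simp_all add: assms)

lemma periodic_smooth_continuous_on:
  assumes "periodic_smooth L I f"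
  shows "continuous_on (I \<times> A) f" "c \<in> I \<Longrightarrow> continuous_on A (\<lambda>x. f (c, x))"
proof -
  have *: "continuous_on (I \<times> UNIV) f"
    using assms smooth_on_imp_continuous_on by (auto simp: periodic_smooth_def)
  show "continuous_on (I \<times> A) f" by (rule continuous_on_subset[OF *]) auto
  show "continuous_on A (\<lambda>x. f (c, x))" if "c \<in> I"
    by (rule continuous_on_compose2[OF *]) (use that in \<open>auto intro!: continuous_intros\<close>)
qed

lemma periodic_smooth_in_Hper:
  assumes "L > 0" "periodic_smooth L I f" "c \<in> I"
  shows "(\<lambda>x. f (c, x)) \<in> Hper L n"
proof -
  define d where "d = (\<lambda>i x. (partial2 ^^ i) f (c, x))"
  have ps: "periodic_smooth L I ((partial2 ^^ i) f)" for i
    by (rule periodic_smooth_funpow[OF periodic_smooth_partial2 assms(2)])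
  have cont: "continuous_on A (d i)" for A i
    unfolding d_def by (rule periodic_smooth_continuous_on(2)[OF ps assms(3)])
  have "bounded (d i ` {0..L})" for i
    by (intro compact_imp_bounded compact_continuous_image cont compact_Icc)
  then have "\<exists>B. \<forall>x\<in>{0..L}. \<bar>d i x\<bar> \<le> B" for i
    by (auto simp: bounded_iff)
  then obtain B where B: "\<And>i x. x \<in> {0..L} \<Longrightarrow> \<bar>d i x\<bar> \<le> B i" by metis
  have decay: "(1 + (of_int m)\<^sup>2) ^ Suc n * (cmod (fourier_coeff L (d 0) m))\<^sup>2
      \<le> (1 + (L\<^sup>2 / (2 * pi\<^sup>2)) ^ Suc n) * (max (B 0) (B (Suc n)))\<^sup>2" for m
  proof (rule fourier_coeff_decay[OF assms(1)])
    show "(d i has_real_derivative d (Suc i) x) (at x)" for i x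
      using periodic_smooth_derivs(2)[OF ps assms(3)] by (simp add: d_def)
    show "d i (x + L) = d i x" for i x
      using ps assms(3) by (auto simp: d_def periodic_smooth_def)
  qed (use B in \<open>auto intro: max.coboundedI1 max.coboundedI2\<close>)
  have "d 0 \<in> Hper L n"
    unfolding Hper_def mem_Collect_eq
  proof (intro conjI allI Hper_weights_summable[OF decay])
    show "d 0 \<in> borel_measurable borel" by (intro borel_measurable_continuous_onI cont)
    show "d 0 (x + L) = d 0 x" for x using assms(2,3) by (simp add: d_def periodic_smooth_def)
    show "set_integrable lborel {0..L} (\<lambda>x. (d 0 x)\<^sup>2)"
      by (intro borel_integrable_atLeastAtMost' continuous_on_power cont)
  qed
  then show ?thesis by (simp add: d_def)
qed

text \<open>Uniform continuity on a compact product makes the modulus of continuity in the parameter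
  independent of x.\<close>

lemma continuous_on_uniform_in_second:
  fixes g :: "real \<times> real \<Rightarrow> real"
  assumes "open I" "c \<in> I" "continuous_on (I \<times> {0..L}) g" "e > 0"
  shows "\<exists>d>0. ball c d \<subseteq> I \<and> (\<forall>s\<in>ball c d. \<forall>x\<in>{0..L}. \<bar>g (s, x) - g (c, x)\<bar> \<le> e)"
proof -
  obtain r where r: "r > 0" "cball c r \<subseteq> I" using assms(1,2) open_contains_cball by blast
  have "compact (cball c r \<times> {0..L})" by (intro compact_Times compact_cball compact_Icc)
  moreover have "continuous_on (cball c r \<times> {0..L}) g"
    by (rule continuous_on_subset[OF assms(3)]) (use r in auto)
  ultimately have "uniformly_continuous_on (cball c r \<times> {0..L}) g"
    by (rule compact_uniformly_continuous[rotated])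
  then obtain d where d: "d > 0"
    "\<And>p q. p \<in> cball c r \<times> {0..L} \<Longrightarrow> q \<in> cball c r \<times> {0..L} \<Longrightarrow> dist q p < d \<Longrightarrow> dist (g q) (g p) < e"
    using assms(4) unfolding uniformly_continuous_on_def by metis
  show ?thesis
  proof (intro exI[of _ "min d r"] conjI ballI)
    show "ball c (min d r) \<subseteq> I" using r by auto
    fix s x assume s: "s \<in> ball c (min d r)" and x: "x \<in> {0..L}"
    have "dist (g (s, x)) (g (c, x)) < e"
      by (rule d(2)) (use s x r in \<open>auto simp: dist_Pair_Pair dist_commute\<close>)
    then show "\<bar>g (s, x) - g (c, x)\<bar> \<le> e" by (simp add: dist_real_def)
  qed (use d r in auto)
qed

text \<open>Leibniz' rule for a single coefficient, taken within a convex S because the mean value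
  estimate runs along a segment in a ball.\<close>

lemma fourier_coeff_has_vector_derivative:
  assumes "periodic_smooth L I f" "s \<in> S" "S \<subseteq> I" "convex S"
  shows "((\<lambda>c. fourier_coeff L (\<lambda>x. f (c, x)) m) has_vector_derivative
    fourier_coeff L (\<lambda>x. partial1 f (s, x)) m) (at s within S)"
proof -
  let ?e = "\<lambda>x. cis (- 2 * pi * of_int m * x / L)"
  have p1: "continuous_on (I \<times> A) (partial1 f)" for A
    using assms(1) smooth_on_imp_continuous_on[OF smooth_on_frechet_derivative] 
    by (auto simp: periodic_smooth_def intro: continuous_on_subset)
  have p1x: "continuous_on A (\<lambda>x. partial1 f (c, x))" if "c \<in> I" for c A
    by (rule continuous_on_compose2[OF p1[of UNIV]]) (use that in \<open>auto intro!: continuous_intros\<close>)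
  have "((\<lambda>c. integral (cbox 0 L) (\<lambda>x. of_real (f (c, x)) * ?e x)) has_vector_derivative
      integral (cbox 0 L) (\<lambda>x. of_real (partial1 f (s, x)) * ?e x)) (at s within S)"
  proof (rule leibniz_rule_vector_derivative)
    fix c x assume c: "c \<in> S"
    then have "c \<in> I" using assms(3) by blast
    have "((\<lambda>c. f (c, x)) has_real_derivative partial1 f (c, x)) (at c within S)"
      by (rule has_field_derivative_at_within[OF periodic_smooth_derivs(1)[OF assms(1) \<open>c \<in> I\<close>]])
    from has_vector_derivative_mult_left[OF has_vector_derivative_of_real[OF this]]
    show "((\<lambda>c. of_real (f (c, x)) * ?e x) has_vector_derivative of_real (partial1 f (c, x)) * ?e x) (at c within S)" .
  next
    fix c assume "c \<in> S"
    then show "(\<lambda>x. of_real (f (c, x)) * ?e x) integrable_on cbox 0 L"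
      using assms(3) by (intro integrable_continuous continuous_on_mult continuous_on_of_real
          continuous_on_fourier_kernel periodic_smooth_continuous_on(2)[OF assms(1)]) auto
  next
    have "continuous_on (S \<times> cbox 0 L) (\<lambda>p. ?e (snd p))"
      by (rule continuous_on_compose2[OF continuous_on_fourier_kernel[of UNIV]]) (auto intro!: continuous_intros)
    then have "continuous_on (S \<times> cbox 0 L) (\<lambda>p. of_real (partial1 f p) * ?e (snd p))"
      by (intro continuous_on_mult continuous_on_of_real continuous_on_subset[OF p1]) (use assms(3) in auto)
    then show "continuous_on (S \<times> cbox 0 L) (\<lambda>(c, x). of_real (partial1 f (c, x)) * ?e x)"
      by (simp add: split_beta)
  qed (use assms in auto)
  from has_vector_derivative_mult_right[OF this, of "of_real (1 / L)"]
  have "((\<lambda>c. of_real (1 / L) * integral {0..L} (\<lambda>x. of_real (f (c, x)) * ?e x)) has_vector_derivative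
      fourier_coeff L (\<lambda>x. partial1 f (s, x)) m) (at s within S)"
    using assms(2,3) by (subst fourier_coeff_eq_integral) (auto intro: p1x simp: cbox_interval)
  then show ?thesis
    by (rule has_vector_derivative_transform[rotated 2])
      (use assms in \<open>auto simp: fourier_coeff_eq_integral periodic_smooth_continuous_on(2)[OF assms(1)]\<close>)
qed

text \<open>Fourier decay of \<open>partial1 f\<close> (s, x) - \<open>partial1 f\<close> (c, x)
  bounds the variation of each coefficient's derivative near c, with the Sobolev weight built in.
  The mean value inequality passes this on to the error of the difference quotient, and summing over
  the frequencies gives K \<epsilon>.\<close>

lemma periodic_smooth_has_Hper_derivative:
  assumes "L > 0" "open I" "periodic_smooth L I f" "c \<in> I"
  shows "has_Hper_derivative L n (\<lambda>c x. f (c, x)) (\<lambda>x. partial1 f (c, x)) c"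
  unfolding has_Hper_derivative_def
proof (rule tendstoI)
  fix e :: real assume "e > 0"
  define C where "C = 1 + (L\<^sup>2 / (2 * pi\<^sup>2)) ^ Suc n"
  define Z where "Z = (\<Sum>\<^sub>\<infinity>m::int. 1 / (1 + (of_int m :: real)\<^sup>2))"
  define K where "K = sqrt (L * (C * Z))"
  \<comment> \<open>Dividing by K + 1 requires only K \<ge> 0 and still gives K \<epsilon> <
    e.\<close>
  define \<epsilon> where "\<epsilon> = e / (K + 1)"
  have C: "C \<ge> 0" by (simp add: C_def)
  have Z: "Z \<ge> 0" unfolding Z_def by (intro infsum_nonneg) auto
  have K: "K \<ge> 0" using C Z assms(1) by (simp add: K_def)
  have \<epsilon>: "\<epsilon> > 0" "K * \<epsilon> < e" using \<open>e > 0\<close> K by (auto simp: \<epsilon>_def field_simps)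
  let ?g = "\<lambda>i. (partial2 ^^ i) (partial1 f)"
  have ps: "periodic_smooth L I (?g i)" for i
    by (rule periodic_smooth_funpow[OF periodic_smooth_partial2 periodic_smooth_partial1[OF assms(2,3)]])
  obtain d0 where d0: "d0 > 0" "ball c d0 \<subseteq> I"
      "\<And>s x. s \<in> ball c d0 \<Longrightarrow> x \<in> {0..L} \<Longrightarrow> \<bar>?g 0 (s, x) - ?g 0 (c, x)\<bar> \<le> \<epsilon>"
    using continuous_on_uniform_in_second[OF assms(2,4) periodic_smooth_continuous_on(1)[OF ps] \<epsilon>(1)] by metis
  obtain d1 where d1: "d1 > 0" "ball c d1 \<subseteq> I"
      "\<And>s x. s \<in> ball c d1 \<Longrightarrow> x \<in> {0..L} \<Longrightarrow> \<bar>?g (Suc n) (s, x) - ?g (Suc n) (c, x)\<bar> \<le> \<epsilon>"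
    using continuous_on_uniform_in_second[OF assms(2,4) periodic_smooth_continuous_on(1)[OF ps] \<epsilon>(1)] by metis
  define \<delta> where "\<delta> = min d0 d1"
  have \<delta>: "\<delta> > 0" "ball c \<delta> \<subseteq> I" using d0 d1 by (auto simp: \<delta>_def)
  let ?q = "\<lambda>m s. fourier_coeff L (\<lambda>x. f (s, x)) m"
  let ?q' = "\<lambda>m s. fourier_coeff L (\<lambda>x. partial1 f (s, x)) m"
  have q'_cont: "continuous_on A (\<lambda>x. partial1 f (s, x))" if "s \<in> I" for s A
    using periodic_smooth_continuous_on(2)[OF ps[of 0] that] by simp
  have q': "(1 + (of_int m)\<^sup>2) ^ Suc n * (cmod (?q' m s - ?q' m c))\<^sup>2 \<le> C * \<epsilon>\<^sup>2" if s: "s \<in> ball c \<delta>" for m s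
  proof -
    let ?d = "\<lambda>i x. ?g i (s, x) - ?g i (c, x)"
    have sI: "s \<in> I" using s \<delta> by auto
    have "(1 + (of_int m)\<^sup>2) ^ Suc n * (cmod (fourier_coeff L (?d 0) m))\<^sup>2 \<le> C * \<epsilon>\<^sup>2"
      unfolding C_def
    proof (rule fourier_coeff_decay[OF assms(1)])
      show "(?d i has_real_derivative ?d (Suc i) x) (at x)" for i x
        using DERIV_diff[OF periodic_smooth_derivs(2)[OF ps sI] periodic_smooth_derivs(2)[OF ps assms(4)]] by simp
      show "?d i (x + L) = ?d i x" for i x
        using ps[of i] sI assms(4) by (simp add: periodic_smooth_def)
    qed (use s d0 d1 in \<open>auto simp: \<delta>_def\<close>)
    then show ?thesis
      using fourier_coeff_diff[OF q'_cont[OF sI] q'_cont[OF assms(4)]] by simp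
  qed
  have main: "Hper_norm L n (\<lambda>x. (f (c + h, x) - f (c, x)) / h - partial1 f (c, x)) \<le> K * \<epsilon>"
    if h: "h \<noteq> 0" "\<bar>h\<bar> < \<delta>" for h
  proof -
    let ?G = "\<lambda>x. (f (c + h, x) - f (c, x)) / h - partial1 f (c, x)"
    have ch: "c + h \<in> ball c \<delta>" "c \<in> ball c \<delta>" using h \<delta> by (auto simp: dist_real_def)
    then have chI: "c + h \<in> I" using \<delta> by blast
    have "(1 + (of_int m)\<^sup>2) ^ Suc n * (cmod (fourier_coeff L ?G m))\<^sup>2 \<le> C * \<epsilon>\<^sup>2" for m
    proof -
      define w where "w = (1 + (of_int m :: real)\<^sup>2) ^ Suc n"
      have w: "w > 0" unfolding w_def by (intro zero_less_power add_pos_nonneg) auto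
      \<comment> \<open>The bound \<open>q'\<close> with the weight divided out, hence dependent on
        the frequency; the weight is restored after the mean value step.\<close>
      define \<beta> where "\<beta> = sqrt (C * \<epsilon>\<^sup>2 / w)"
      have "norm (?q' m s - ?q' m c) \<le> \<beta>" if "s \<in> ball c \<delta>" for s
        unfolding \<beta>_def using q'[OF that, of m, folded w_def] w by (intro real_le_rsqrt) (simp add: field_simps)
      moreover have "(?q m has_vector_derivative ?q' m s) (at s within ball c \<delta>)" if "s \<in> ball c \<delta>" for s
        by (rule fourier_coeff_has_vector_derivative[OF assms(3) that \<delta>(2)]) simp
      moreover have "closed_segment c (c + h) \<subseteq> ball c \<delta>"
        using ch by (intro closed_segment_subset) auto
      ultimately have "norm (?q m (c + h) - ?q m c - (c + h - c) *\<^sub>R ?q' m c) \<le> norm (c + h - c) * \<beta>"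
        by (intro vector_differentiable_bound_linearization[where S="ball c \<delta>"] ch)
      then have lin: "norm (?q m (c + h) - ?q m c - h *\<^sub>R ?q' m c) \<le> \<bar>h\<bar> * \<beta>" by simp
      have cG: "continuous_on {0..L} (\<lambda>x. 1 / h * (f (c + h, x) - f (c, x)))"
        by (intro continuous_on_mult continuous_on_const continuous_on_diff
            periodic_smooth_continuous_on(2)[OF assms(3)] chI assms(4))
      have "fourier_coeff L ?G m = fourier_coeff L (\<lambda>x. 1 / h * (f (c + h, x) - f (c, x))) m - ?q' m c"
        using fourier_coeff_diff[OF cG q'_cont[OF assms(4)]] by simp
      also have "\<dots> = of_real (1 / h) * (?q m (c + h) - ?q m c) - ?q' m c"
        using periodic_smooth_continuous_on(2)[OF assms(3)] chI assms(4)
        by (simp only: fourier_coeff_scale fourier_coeff_diff)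
      also have "\<dots> = (1 / h) *\<^sub>R (?q m (c + h) - ?q m c - h *\<^sub>R ?q' m c)"
        using h by (simp add: scaleR_conv_of_real right_diff_distrib)
      finally have "cmod (fourier_coeff L ?G m) = norm (?q m (c + h) - ?q m c - h *\<^sub>R ?q' m c) / \<bar>h\<bar>"
        by simp
      also have "\<dots> \<le> \<beta>" using lin h by (simp add: field_simps)
      finally have "(cmod (fourier_coeff L ?G m))\<^sup>2 \<le> \<beta>\<^sup>2" by (intro power_mono) auto
      also have "\<beta>\<^sup>2 = C * \<epsilon>\<^sup>2 / w" unfolding \<beta>_def using C w by (intro real_sqrt_pow2) simp
      finally show ?thesis unfolding w_def[symmetric] using w by (simp add: field_simps)
    qed
    from Hper_norm_le[OF this assms(1)]
    have "Hper_norm L n ?G \<le> sqrt (L * (C * \<epsilon>\<^sup>2 * Z))" by (simp add: Z_def)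
    also have "\<dots> = sqrt (L * (C * Z) * \<epsilon>\<^sup>2)" by (simp add: mult_ac)
    also have "\<dots> = K * \<epsilon>" using \<epsilon>(1) by (simp add: K_def real_sqrt_mult)
    finally show ?thesis .
  qed
  show "\<forall>\<^sub>F h in at 0. dist (Hper_norm L n (\<lambda>x. (f (c + h, x) - f (c, x)) / h - partial1 f (c, x))) 0 < e"
    unfolding eventually_at
  proof (intro exI[of _ \<delta>] conjI ballI impI \<delta>(1))
    fix h :: real assume "h \<noteq> 0 \<and> dist h 0 < \<delta>"
    then have "Hper_norm L n (\<lambda>x. (f (c + h, x) - f (c, x)) / h - partial1 f (c, x)) < e"
      using main[of h] \<epsilon>(2) by simp
    then show "dist (Hper_norm L n (\<lambda>x. (f (c + h, x) - f (c, x)) / h - partial1 f (c, x))) 0 < e"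
      using Hper_norm_nonneg[OF assms(1)] by (simp add: dist_real_def)
  qed
qed

text \<open>The iterated c-derivatives of f stay jointly smooth and periodic, so the first-order
  result applies at every order.\<close>

lemma periodic_smooth_imp_Hper_smooth_on:
  assumes "L > 0" "open I" "periodic_smooth L I f"
  shows "Hper_smooth_on L n I (\<lambda>c x. f (c, x))"
  unfolding Hper_smooth_on_def
proof (intro exI[of _ "\<lambda>j c x. (partial1 ^^ j) f (c, x)"] conjI allI ballI)
  fix j c assume c: "c \<in> I"
  have ps: "periodic_smooth L I ((partial1 ^^ j) f)"
    by (rule periodic_smooth_funpow[OF periodic_smooth_partial1[OF assms(2)] assms(3)])
  show "(\<lambda>x. (partial1 ^^ j) f (c, x)) \<in> Hper L n"
    by (rule periodic_smooth_in_Hper[OF assms(1) ps c])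
  show "has_Hper_derivative L n (\<lambda>c x. (partial1 ^^ j) f (c, x)) (\<lambda>x. (partial1 ^^ Suc j) f (c, x)) c"
    using periodic_smooth_has_Hper_derivative[OF assms(1,2) ps c] by simp
qed simp

theorem corollary1:
  fixes L :: real
  assumes "L > 0"
  shows "(\<forall>c\<in>{2 * pi\<^sup>2 / L\<^sup>2 <..}.
            fundamental_period (phi L c) L \<and>
            (\<forall>x. phi L c differentiable (at x) \<and> deriv (phi L c) differentiable (at x) \<and>
                 - deriv (deriv (phi L c)) x + 2 * c * phi L c x - 2 * (phi L c x)\<^sup>2 = 0)) \<and>
         (\<forall>n. Hper_smooth_on L n {2 * pi\<^sup>2 / L\<^sup>2 <..} (\<lambda>c. phi L c)) \<and>
         (\<forall>c\<in>{2 * pi\<^sup>2 / L\<^sup>2 <..}.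
            \<exists>d>0. ((\<lambda>c. modulus L (2 * c)) has_real_derivative d) (at c))"
proof (intro conjI allI ballI)
  fix c assume "c \<in> {2 * pi\<^sup>2 / L\<^sup>2<..}"
  then have c: "2 * pi\<^sup>2 / L\<^sup>2 < c" by simp
  show "fundamental_period (phi L c) L" by (rule phi_fundamental_period[OF assms c])
  show "\<exists>d>0. ((\<lambda>c. modulus L (2 * c)) has_real_derivative d) (at c)"
    by (rule modulus_deriv_pos[OF assms c])
  fix x
  show "phi L c differentiable (at x)" "deriv (phi L c) differentiable (at x)"
    "- deriv (deriv (phi L c)) x + 2 * c * phi L c x - 2 * (phi L c x)\<^sup>2 = 0"
    by (rule phi_ode[OF assms c])+
next
  fix n
  have "phi L c (x + L) = phi L c x" if "c > 2 * pi\<^sup>2 / L\<^sup>2" for c x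
    using phi_fundamental_period[OF assms that] by (simp add: fundamental_period_def)
  then have "periodic_smooth L {2 * pi\<^sup>2 / L\<^sup>2<..} (\<lambda>(c, x). phi L c x)"
    using smooth_on_phi[OF assms] by (simp add: periodic_smooth_def)
  from periodic_smooth_imp_Hper_smooth_on[OF assms _ this]
  show "Hper_smooth_on L n {2 * pi\<^sup>2 / L\<^sup>2<..} (\<lambda>c. phi L c)" by simp
qed

end
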